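(* Let $f,g:(\mathbb C^n,0)\to(\mathbb C,0)$ be complex analytic function germs with an isolated singularity at the origin. Suppose that $f$ and $g$ are bi-Lipschitz $\mathcal A$-equivalent or bi-Lipschitz $\mathcal K^*$-equivalent. Then $\mathcal L_0(\nabla f)=\mathcal L_0(\nabla g)$.
   Context: For real function germs at $0$, $a(x)\lesssim b(x)$ near $0$ means there are a constant $C>0$ and an open neighbourhood $U$ of $0$ with $a(x)\leq C\,b(x)$ for all $x\in U$. $\nabla f=(\partial f/\partial x_1,\dots,\partial f/\partial x_n)$. $\mathcal L_0(\nabla f)$ is the infimum of those $\alpha\in\mathbb R_{\geq 0}$ such that $\|x\|^\alpha\lesssim\|\nabla f(x)\|$ near $0$. A map (germ) $h$ is Lipschitz if $\|h(x)-h(x')\|\lesssim\|x-x'\|$ near $0$. A homeomorphism germ $h$ is bi-Lipschitz if $h$ and $h^{-1}$ are Lipschitz. Map germs $f,g:(\mathbb C^n,0)\to(\mathbb C^p,0)$ are bi-Lipschitz $\mathcal A$-equivalent if there are bi-Lipschitz homeomorphisms $\varphi:(\mathbb C^n,0)\to(\mathbb C^n,0)$ and $\phi:(\mathbb C^p,0)\to(\mathbb C^p,0)$ with $\phi(f(x))=g(\varphi(x))$ for all $x$ in some open neighbourhood of $0$. They are bi-Lipschitz $\mathcal K^*$-equivalent if there are a bi-Lipschitz homeomorphism $\varphi:(\mathbb C^n,0)\to(\mathbb C^n,0)$ and a map germ $A$ at $0\in\mathbb C^n$ with values in $\mathrm{GL}(\mathbb C^p)$ such that $x\mapsto A(x)$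 and $x\mapsto A(x)^{-1}$ are Lipschitz and $A(x)f(x)=g(\varphi(x))$ for all $x$ in some open neighbourhood of $0$. *)

theory Defs
  imports "HOL-Analysis.Analysis"
begin

text \<open>
  Germs at 0 are represented by total functions; every notion below depends only on
  the values on some neighbourhood of 0.
\<close>

definition lesssim_at_0 :: "('a::{topological_space,zero} \<Rightarrow> real) \<Rightarrow> ('a \<Rightarrow> real) \<Rightarrow> bool"
  where "lesssim_at_0 a b \<longleftrightarrow>
    (\<exists>C>0. \<exists>U. open U \<and> 0 \<in> U \<and> (\<forall>x\<in>U. a x \<le> C * b x))"

text \<open>A germ at 0 in several complex variables is analytic if it is given near 0 by a convergent
  power series; multi-indices are functions \<open>\<alpha> :: 'n \<Rightarrow> nat\<close>.\<close>

definition analytic_germ :: "(complex^'n \<Rightarrow> complex) \<Rightarrow> bool"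
  where "analytic_germ f \<longleftrightarrow>
    (\<exists>c :: ('n \<Rightarrow> nat) \<Rightarrow> complex. \<exists>U. open U \<and> 0 \<in> U \<and>
      (\<forall>x\<in>U. ((\<lambda>\<alpha>. c \<alpha> * (\<Prod>i\<in>UNIV. (x $ i) ^ \<alpha> i)) has_sum f x) UNIV))"

definition gradient :: "(complex^'n \<Rightarrow> complex) \<Rightarrow> complex^'n \<Rightarrow> complex^'n"
  where "gradient f x = (\<chi> i. deriv (\<lambda>z. f (\<chi> j. if j = i then z else x $ j)) (x $ i))"

definition isolated_singularity_at_0 :: "(complex^'n \<Rightarrow> complex) \<Rightarrow> bool"
  where "isolated_singularity_at_0 f \<longleftrightarrow>
    gradient f 0 = 0 \<and> (\<exists>U. open U \<and> 0 \<in> U \<and> (\<forall>x\<in>U - {0}. gradient f x \<noteq> 0))"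

text \<open>The infimum is taken in the extended reals, so that it is \<open>\<infinity>\<close> if no exponent is admissible.
  The library's convention \<open>0 powr 0 = 0\<close> is harmless: it concerns only the inequality for
  \<open>\<alpha> = 0\<close> at the single point 0, which for continuous \<open>F\<close> follows (up to the constant) from
  the inequality at nearby points.\<close>

definition Lojasiewicz_exponent :: "(complex^'n \<Rightarrow> complex^'m) \<Rightarrow> ereal"
  where "Lojasiewicz_exponent F =
    (INF \<alpha> \<in> {\<alpha>::real. 0 \<le> \<alpha> \<and> lesssim_at_0 (\<lambda>x. norm x powr \<alpha>) (\<lambda>x. norm (F x))}. ereal \<alpha>)"

definition Lipschitz_germ :: "('a::real_normed_vector \<Rightarrow> 'b::real_normed_vector) \<Rightarrow> bool"
  where "Lipschitz_germ h \<longleftrightarrow>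
    lesssim_at_0 (\<lambda>(x, x'). norm (h x - h x')) (\<lambda>(x, x'). norm (x - x'))"

definition bi_Lipschitz_homeo_germ :: "('a::real_normed_vector \<Rightarrow> 'a) \<Rightarrow> bool"
  where "bi_Lipschitz_homeo_germ h \<longleftrightarrow>
    h 0 = 0 \<and>
    (\<exists>U V k. open U \<and> open V \<and> 0 \<in> U \<and> 0 \<in> V \<and> homeomorphism U V h k \<and>
       Lipschitz_germ h \<and> Lipschitz_germ k)"

text \<open>The target type is left general so that it can be \<open>complex\<close> as well as \<open>complex^'p\<close>.\<close>

definition bi_Lipschitz_A_equivalent ::
    "(complex^'n \<Rightarrow> 'b::real_normed_vector) \<Rightarrow> (complex^'n \<Rightarrow> 'b) \<Rightarrow> bool"
  where "bi_Lipschitz_A_equivalent f g \<longleftrightarrow>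
    (\<exists>\<phi> \<psi>. bi_Lipschitz_homeo_germ \<phi> \<and> bi_Lipschitz_homeo_germ \<psi> \<and>
       (\<exists>U. open U \<and> 0 \<in> U \<and> (\<forall>x\<in>U. \<psi> (f x) = g (\<phi> x))))"

definition bi_Lipschitz_K_star_equivalent ::
    "(complex^'n \<Rightarrow> complex^'p) \<Rightarrow> (complex^'n \<Rightarrow> complex^'p) \<Rightarrow> bool"
  where "bi_Lipschitz_K_star_equivalent f g \<longleftrightarrow>
    (\<exists>\<phi>. \<exists>A :: complex^'n \<Rightarrow> complex^'p^'p.
       bi_Lipschitz_homeo_germ \<phi> \<and>
       Lipschitz_germ A \<and> Lipschitz_germ (\<lambda>x. matrix_inv (A x)) \<and>
       (\<exists>U. open U \<and> 0 \<in> U \<and> (\<forall>x\<in>U. invertible (A x) \<and> A x *v f x = g (\<phi> x))))"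

end

theory Submission
  imports Defs
begin

text \<open>
  The norm of the gradient of a complex differentiable function is its pointwise Lipschitz
  constant, and bi-Lipschitz changes of coordinates in source and target alter Lipschitz constants by bounded
  factors only. For an \<open>A\<close>-equivalence \<open>\<psi> \<circ> f = g \<circ> \<phi>\<close> this shows that \<open>norm (gradient f x)\<close> and
  \<open>norm (gradient g (\<phi> x))\<close> are comparable near 0, although \<open>\<phi>\<close> and \<open>\<psi>\<close> need not be differentiable; and since
  \<open>norm (\<phi> x)\<close> is comparable with \<open>norm x\<close>, the Lojasiewicz exponents agree.

  For a \<open>K\<close>*-equivalence one has \<open>f x = b x * g (\<phi> x)\<close> with a Lipschitz factor \<open>b\<close>, whose variation contributes
  a term \<open>norm (g (\<phi> x))\<close> to the estimate of \<open>norm (gradient f x)\<close> (lemmas \<open>difference_dominated_multiply\<close> and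
  \<open>norm_gradient_le_of_domination\<close>). It is absorbed by the inequality \<open>norm (g y) \<le> C * norm (gradient g y)\<close>
  near 0 (\<open>analytic_germ_le_gradient\<close>), which is the analytic heart of the matter. It is a consequence
  of the Lojasiewicz gradient inequality, but for an isolated singularity it has the following
  direct proof.

  Let \<open>F\<close> be the gradient of \<open>f\<close> and \<open>L x = x \<cdot> F x - f x\<close> its Legendre transform. From \<open>dL = x \<cdot> dF\<close> one sees that on a path
  along which \<open>F\<close> runs straight from \<open>F w\<close> to 0, and which stays in the ball of radius \<open>R\<close>, the transform
  \<open>L\<close> varies by at most \<open>R * norm (F w)\<close>. The path ends at the only zero 0 of \<open>F\<close>, where \<open>L = 0\<close>, so
  \<open>norm (L w) \<le> R * norm (F w)\<close>, and the claim for \<open>f w = w \<cdot> F w - L w\<close> follows.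

  Such a path may meet singular points of the Hessian. Therefore \<open>f\<close> is perturbed by the form
  \<open>(\<Sum>j. d\<^sub>j * x\<^sub>j\<^sup>2) / 2\<close>. A dimension count (\<open>negligible_degenerate\<close>) shows that, for \<open>d\<close> arbitrarily small and
  starting points arbitrarily near \<open>w\<close>, the segment contains no critical value of the perturbed gradient except
  possibly its end 0 (\<open>regular_perturbation_exists\<close>). Then a maximum
  argument makes the path superfluous (\<open>legendre_ray_bound\<close>), and \<open>d\<close> tends to 0 (\<open>legendre_le_gradient\<close>).
\<close>

section \<open>Power series in several complex variables\<close>

definition polydisc :: "real \<Rightarrow> (complex^'n) set"
  where "polydisc r = {x. \<forall>i. norm (x $ i) < r}"

definition monomial :: "('n::finite \<Rightarrow> nat) \<Rightarrow> complex^'n \<Rightarrow> complex"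
  where "monomial \<alpha> x = (\<Prod>i\<in>UNIV. (x $ i) ^ \<alpha> i)"

text \<open>
  The partial derivative of a monomial in the \<open>i\<close>-th variable. For \<open>\<alpha> i = 0\<close> the truncated exponent
  is harmless, because the factor \<open>\<alpha> i\<close> vanishes.
\<close>

definition monomial_deriv :: "'n::finite \<Rightarrow> ('n \<Rightarrow> nat) \<Rightarrow> complex^'n \<Rightarrow> complex"
  where "monomial_deriv i \<alpha> x =
    of_nat (\<alpha> i) * (x $ i) ^ (\<alpha> i - 1) * (\<Prod>j\<in>UNIV - {i}. (x $ j) ^ \<alpha> j)"

definition power_series_on :: "real \<Rightarrow> (complex^'n \<Rightarrow> complex) \<Rightarrow> bool"
  where "power_series_on r f \<longleftrightarrow>
    (\<exists>c. \<forall>x\<in>polydisc r. ((\<lambda>\<alpha>. c \<alpha> * monomial \<alpha> x) has_sum f x) UNIV)"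

lemma zero_in_polydisc: "0 < r \<Longrightarrow> 0 \<in> polydisc r"
  by (simp add: polydisc_def)

lemma polydisc_mono: "r \<le> s \<Longrightarrow> polydisc r \<subseteq> polydisc s"
  by (fastforce simp: polydisc_def intro: less_le_trans)

lemma open_polydisc: "open (polydisc r :: (complex^'n) set)"
proof -
  have "polydisc r = (\<Inter>i. {x::complex^'n. norm (x $ i) < r})"
    by (auto simp: polydisc_def)
  moreover have "open {x::complex^'n. norm (x $ i) < r}" for i
    by (intro open_Collect_less continuous_intros)
  ultimately show ?thesis by (metis (no_types, lifting) open_INT finite_class.finite_UNIV)
qed

lemma convex_polydisc: "convex (polydisc r :: (complex^'n) set)"
proof -
  have "polydisc r = (\<Inter>i. (\<lambda>x::complex^'n. x $ i) -` ball 0 r)"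
    by (auto simp: polydisc_def)
  then show ?thesis
    by (auto intro!: convex_INT convex_linear_vimage bounded_linear.linear[OF bounded_linear_vec_nth])
qed

lemma polydisc_in_neighbourhood:
  fixes U :: "(complex^'n) set"
  assumes "open U" "0 \<in> U"
  obtains r where "0 < r" "polydisc r \<subseteq> U"
proof -
  obtain e where e: "e > 0" "ball 0 e \<subseteq> U"
    using assms openE by blast
  define r where "r = e / CARD('n)"
  have "norm x < e" if "x \<in> polydisc r" for x :: "complex^'n"
  proof -
    have "norm x \<le> (\<Sum>i\<in>UNIV. norm (x $ i))"
      by (simp add: norm_vec_def L2_set_le_sum)
    also have "\<dots> < (\<Sum>i\<in>(UNIV::'n set). r)"
      using that by (intro sum_strict_mono) (auto simp: polydisc_def)
    finally show ?thesis by (simp add: r_def)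
  qed
  then show thesis
    using e by (intro that[of r]) (auto simp: r_def)
qed

lemma has_derivative_monomial:
  "(monomial \<alpha> has_derivative (\<lambda>h. \<Sum>i\<in>UNIV. monomial_deriv i \<alpha> x * h $ i)) (at x)"
proof -
  have "((\<lambda>x. \<Prod>i\<in>UNIV. (x $ i) ^ \<alpha> i) has_derivative
     (\<lambda>h. \<Sum>i\<in>UNIV. (of_nat (\<alpha> i) * h $ i * (x $ i) ^ (\<alpha> i - 1)) * (\<Prod>j\<in>UNIV - {i}. (x $ j) ^ \<alpha> j))) (at x)"
    by (intro has_derivative_prod)
       (auto intro!: derivative_eq_intros bounded_linear_imp_has_derivative[OF bounded_linear_vec_nth])
  then show ?thesis
    by (simp add: monomial_def[abs_def] monomial_deriv_def mult_ac)
qed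

text \<open>
  Differentiating a monomial costs a factor of at most its total degree \<open>k\<close>. Passing from the polyradius
  \<open>s'\<close> to \<open>s\<close> gains \<open>(s / s') ^ k\<close>, and \<open>k * (s / s') ^ k\<close> is bounded, so the derivatives are dominated by
  the monomials at polyradius \<open>s'\<close>, uniformly in the multi-index.
\<close>

lemma norm_monomial_deriv_le:
  assumes "0 < s" "s < s'"
  obtains K where "\<And>\<alpha> i (x::complex^'n). x \<in> polydisc s \<Longrightarrow>
     norm (monomial_deriv i \<alpha> x) \<le> K * s' ^ sum \<alpha> UNIV"
proof -
  define q where "q = s / s'"
  have q: "0 < q" "q < 1" using assms by (auto simp: q_def)
  have "Bseq (\<lambda>k. of_nat k * q ^ k)"
    using powser_times_n_limit_0[of q] q by (intro convergent_imp_Bseq convergentI) auto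
  then obtain B where B: "\<And>k. norm (real k * q ^ k) \<le> B"
    by (auto simp: Bseq_def)
  have "norm (monomial_deriv i \<alpha> x) \<le> B / s * s' ^ sum \<alpha> UNIV"
    if x: "x \<in> polydisc s" for \<alpha> i and x :: "complex^'n"
  proof (cases "\<alpha> i = 0")
    case True
    have "0 \<le> B" using B[of 0] by simp
    then show ?thesis using True assms by (simp add: monomial_deriv_def)
  next
    case False
    define m where "m = sum \<alpha> UNIV"
    have m: "m = \<alpha> i + sum \<alpha> (UNIV - {i})"
      unfolding m_def by (simp add: sum.remove)
    have le: "norm (x $ j) \<le> s" for j
      using x by (auto simp: polydisc_def intro: less_imp_le)
    have "norm (monomial_deriv i \<alpha> x) = real (\<alpha> i) * norm (x $ i) ^ (\<alpha> i - 1)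
        * (\<Prod>j\<in>UNIV - {i}. norm (x $ j) ^ \<alpha> j)"
      by (simp add: monomial_deriv_def norm_mult norm_power prod_norm[symmetric])
    also have "\<dots> \<le> real (\<alpha> i) * s ^ (\<alpha> i - 1) * (\<Prod>j\<in>UNIV - {i}. s ^ \<alpha> j)"
      using le assms by (intro mult_mono prod_mono power_mono conjI mult_nonneg_nonneg prod_nonneg) auto
    also have "\<dots> = real (\<alpha> i) * (s ^ \<alpha> i * (\<Prod>j\<in>UNIV - {i}. s ^ \<alpha> j)) / s"
      using False assms by (simp add: power_eq_if[of s "\<alpha> i"])
    also have "s ^ \<alpha> i * (\<Prod>j\<in>UNIV - {i}. s ^ \<alpha> j) = s ^ m"
      by (simp add: m power_add power_sum)
    also have "real (\<alpha> i) * s ^ m / s \<le> real m * s ^ m / s"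
      using assms m by (intro divide_right_mono mult_right_mono) (auto simp del: of_nat_sum)
    also have "\<dots> = real m * q ^ m * s' ^ m / s"
      using assms by (simp add: q_def power_divide)
    also have "\<dots> \<le> B * s' ^ m / s"
      using B[of m] assms q by (intro divide_right_mono mult_right_mono) auto
    finally show ?thesis by (simp add: m_def)
  qed
  then show thesis using that by blast
qed

lemma multi_index_enumeration:
  obtains e :: "nat \<Rightarrow> ('n::finite \<Rightarrow> nat)" where "bij e"
proof -
  have "infinite (UNIV :: ('n \<Rightarrow> nat) set)"
  proof
    assume "finite (UNIV :: ('n \<Rightarrow> nat) set)"
    then have "finite (range (\<lambda>k::nat. (\<lambda>_::'n. k)))"
      by (rule finite_subset[rotated]) simp
    moreover have "inj (\<lambda>k::nat. (\<lambda>_::'n. k))"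
      by (auto simp: inj_def fun_eq_iff)
    ultimately show False using finite_imageD infinite_UNIV_nat by blast
  qed
  then show thesis
    using bij_betw_from_nat_into[of "UNIV :: ('n \<Rightarrow> nat) set"] that by auto
qed

text \<open>
  Termwise differentiation: the preceding bound dominates the differentiated series on the smaller
  polydisc by a summable one, so its partial sums converge uniformly. Since the partial
  derivatives are power series themselves, the lemma can be iterated; each use costs a
  shrinking of the polydisc.
\<close>

lemma power_series_has_derivative:
  fixes f :: "complex^'n \<Rightarrow> complex"
  assumes f: "power_series_on r f" and s: "0 < s" "s < r"
  obtains D where "\<And>i. power_series_on s (D i)"
    and "\<And>x. x \<in> polydisc s \<Longrightarrow>
          (f has_derivative (\<lambda>h. \<Sum>i\<in>UNIV. D i x * h $ i)) (at x)"
proof -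
  obtain c where c: "\<And>x. x \<in> polydisc r \<Longrightarrow> ((\<lambda>\<alpha>. c \<alpha> * monomial \<alpha> x) has_sum f x) UNIV"
    using f unfolding power_series_on_def by blast
  obtain s' where s': "s < s'" "s' < r" using s dense by blast
  obtain K where K: "\<And>\<alpha> i (x::complex^'n). x \<in> polydisc s \<Longrightarrow>
     norm (monomial_deriv i \<alpha> x) \<le> K * s' ^ sum \<alpha> UNIV"
    using norm_monomial_deriv_le[OF s(1) s'(1)] by metis
  define b where "b \<alpha> = norm (c \<alpha>) * (K * s' ^ sum \<alpha> UNIV)" for \<alpha>
  \<comment> \<open>unconditional convergence at the point with all coordinates \<open>s'\<close> is absolute convergence\<close>
  have mon: "monomial \<alpha> (\<chi> i. of_real s') = of_real s' ^ sum \<alpha> UNIV" for \<alpha> :: "'n \<Rightarrow> nat"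
    by (simp add: monomial_def power_sum)
  have "(\<chi> i. of_real s') \<in> (polydisc r :: (complex^'n) set)"
    using s s' by (auto simp: polydisc_def)
  from c[OF this] have "(\<lambda>\<alpha>. norm (c \<alpha> * of_real s' ^ sum \<alpha> (UNIV::'n set))) summable_on UNIV"
    unfolding mon by (metis summable_on_iff_abs_summable_on_complex has_sum_imp_summable)
  then have "(\<lambda>\<alpha>. norm (c \<alpha> * of_real s' ^ sum \<alpha> (UNIV::'n set)) * K) summable_on UNIV"
    by (rule summable_on_cmult_left)
  then have b: "b summable_on UNIV"
    using s s' by (simp add: b_def[abs_def] norm_mult norm_power mult_ac)
  define t where "t i x \<alpha> = c \<alpha> * monomial_deriv i \<alpha> x" for i \<alpha> and x :: "complex^'n"
  have tb: "norm (t i x \<alpha>) \<le> b \<alpha>" if "x \<in> polydisc s" for i \<alpha> x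
    unfolding t_def b_def norm_mult using K[OF that] by (intro mult_left_mono) auto
  define D where "D i x = infsum (t i x) UNIV" for i x
  have tD: "(t i x has_sum D i x) UNIV" if "x \<in> polydisc s" for i x
  proof -
    have "t i x summable_on UNIV"
      using summable_on_comparison_test[OF b, of "\<lambda>\<alpha>. norm (t i x \<alpha>)"] tb[OF that]
      by (simp add: summable_on_iff_abs_summable_on_complex)
    then show ?thesis by (simp add: D_def)
  qed
  \<comment> \<open>terms with \<open>\<alpha> i = 0\<close> vanish; the others are indexed bijectively by lowering \<open>\<alpha> i\<close> by one\<close>
  have 1: "power_series_on s (D i)" for i
    unfolding power_series_on_def
  proof (intro exI ballI)
    fix x :: "complex^'n" assume x: "x \<in> polydisc s"
    define up where "up \<alpha> = \<alpha>(i := Suc (\<alpha> i))" for \<alpha> :: "'n \<Rightarrow> nat"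
    have "inj up" by (auto simp: inj_def up_def fun_eq_iff)
    have range: "range up = {\<alpha>. \<alpha> i > 0}"
    proof (intro set_eqI iffI)
      fix \<alpha> :: "'n \<Rightarrow> nat" assume "\<alpha> \<in> {\<alpha>. \<alpha> i > 0}"
      then have "\<alpha> = up (\<alpha>(i := \<alpha> i - 1))" by (auto simp: up_def)
      then show "\<alpha> \<in> range up" by blast
    qed (auto simp: up_def)
    have "(t i x has_sum D i x) (range up)"
      unfolding range using tD[OF x, of i]
      by (rule has_sum_cong_neutral[THEN iffD1, rotated -1]) (auto simp: t_def monomial_deriv_def)
    then have "((t i x \<circ> up) has_sum D i x) UNIV"
      using has_sum_reindex[OF \<open>inj up\<close>] by blast
    moreover have "(t i x \<circ> up) \<alpha> = (c (up \<alpha>) * of_nat (Suc (\<alpha> i))) * monomial \<alpha> x" for \<alpha>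
    proof -
      have "monomial \<alpha> x = x $ i ^ \<alpha> i * (\<Prod>j\<in>UNIV - {i}. x $ j ^ \<alpha> j)"
        unfolding monomial_def by (simp add: prod.remove)
      then show ?thesis
        by (simp add: t_def up_def monomial_deriv_def)
    qed
    ultimately show "((\<lambda>\<alpha>. (c (\<alpha>(i := Suc (\<alpha> i))) * of_nat (Suc (\<alpha> i))) * monomial \<alpha> x) has_sum D i x) UNIV"
      by (simp add: o_def up_def cong: has_sum_cong)
  qed
  obtain e :: "nat \<Rightarrow> ('n \<Rightarrow> nat)" where e: "bij e" by (rule multi_index_enumeration)
  have be: "(\<lambda>n. b (e n)) summable_on UNIV"
    using summable_on_reindex_bij_betw[of e UNIV UNIV b] e b by simp
  have tDe: "(\<lambda>n. t i x (e n)) sums D i x" if "x \<in> polydisc s" for i x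
    using has_sum_reindex_bij_betw[of e UNIV UNIV "t i x"] e tD[OF that]
    by (intro has_sum_imp_sums) simp
  have ce: "(\<lambda>n. c (e n) * monomial (e n) x) sums f x" if "x \<in> polydisc s" for x
    using has_sum_reindex_bij_betw[of e UNIV UNIV "\<lambda>\<alpha>. c \<alpha> * monomial \<alpha> x"] e
      c[of x] that polydisc_mono[of s r] s
    by (intro has_sum_imp_sums) auto
  have be': "summable (\<lambda>n. b (e n))"
    using be summable_on_imp_summable by blast
  have 2: "(f has_derivative (\<lambda>h. \<Sum>i\<in>UNIV. D i x * h $ i)) (at x)" if x: "x \<in> polydisc s" for x
  proof -
    have "\<exists>g. \<forall>x\<in>polydisc s. (\<lambda>n. c (e n) * monomial (e n) x) sums g x \<and>
        (g has_derivative (\<lambda>h. \<Sum>i\<in>UNIV. D i x * h $ i)) (at x within polydisc s)"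
    proof (rule has_derivative_series[where f' = "\<lambda>n x h. \<Sum>i\<in>UNIV. t i x (e n) * h $ i"
            and f = "\<lambda>n x. c (e n) * monomial (e n) x", OF convex_polydisc _ _ x ce[OF x]])
      show "((\<lambda>x. c (e n) * monomial (e n) x) has_derivative (\<lambda>h. \<Sum>i\<in>UNIV. t i x (e n) * h $ i))
          (at x within polydisc s)" for n and x :: "complex^'n"
        by (rule derivative_eq_intros has_derivative_at_withinI[OF has_derivative_monomial] refl)+
          (simp add: t_def sum_distrib_left mult_ac)
    next
      fix \<epsilon> :: real assume "\<epsilon> > 0"
      have "(\<lambda>n. \<Sum>k. b (e (k + n))) \<longlonglongrightarrow> 0"
        using suminf_exist_split2[OF be'] .
      then have "\<forall>\<^sub>F n in sequentially. norm (\<Sum>k. b (e (k + n))) < \<epsilon> / CARD('n)"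
        using \<open>\<epsilon> > 0\<close> by (auto simp: tendsto_iff dist_norm)
      then show "\<forall>\<^sub>F n in sequentially. \<forall>x\<in>polydisc s. \<forall>h.
         norm ((\<Sum>k<n. \<Sum>i\<in>UNIV. t i x (e k) * h $ i) - (\<Sum>i\<in>UNIV. D i x * h $ i)) \<le> \<epsilon> * norm h"
      proof (eventually_elim, intro ballI allI)
        fix n and x h :: "complex^'n"
        assume n: "norm (\<Sum>k. b (e (k + n))) < \<epsilon> / CARD('n)" and x: "x \<in> polydisc s"
        have tail: "norm ((\<Sum>k<n. t i x (e k)) - D i x) \<le> \<epsilon> / CARD('n)" for i
        proof -
          have "(\<lambda>k. t i x (e (k + n))) sums (D i x - (\<Sum>k<n. t i x (e k)))"
            using tDe[OF x] by (rule sums_split_initial_segment)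
          then have eq: "D i x - (\<Sum>k<n. t i x (e k)) = (\<Sum>k. t i x (e (k + n)))"
            by (rule sums_unique)
          have sb: "summable (\<lambda>k. b (e (k + n)))"
            using be' by (rule summable_ignore_initial_segment)
          have "norm (D i x - (\<Sum>k<n. t i x (e k))) \<le> (\<Sum>k. b (e (k + n)))"
            unfolding eq by (rule norm_suminf_le[OF _ sb]) (rule tb[OF x])
          also have "\<dots> \<le> norm (\<Sum>k. b (e (k + n)))" by simp
          also have "\<dots> \<le> \<epsilon> / CARD('n)" using n by (rule less_imp_le)
          finally show ?thesis by (subst norm_minus_commute)
        qed
        have "norm ((\<Sum>k<n. \<Sum>i\<in>UNIV. t i x (e k) * h $ i) - (\<Sum>i\<in>UNIV. D i x * h $ i))
          = norm (\<Sum>i\<in>UNIV. ((\<Sum>k<n. t i x (e k)) - D i x) * h $ i)"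
          by (subst sum.swap) (simp add: sum_distrib_right sum_subtractf left_diff_distrib)
        also have "\<dots> \<le> (\<Sum>i\<in>(UNIV::'n set). \<epsilon> / CARD('n) * norm h)"
        proof (rule sum_norm_le)
          fix i
          show "norm (((\<Sum>k<n. t i x (e k)) - D i x) * h $ i) \<le> \<epsilon> / CARD('n) * norm h"
            unfolding norm_mult using \<open>\<epsilon> > 0\<close>
            by (intro mult_mono tail Finite_Cartesian_Product.norm_nth_le) auto
        qed
        finally show "norm ((\<Sum>k<n. \<Sum>i\<in>UNIV. t i x (e k) * h $ i) - (\<Sum>i\<in>UNIV. D i x * h $ i)) \<le> \<epsilon> * norm h"
          by simp
      qed
    qed
    then obtain g where g: "\<And>x. x \<in> polydisc s \<Longrightarrow> (\<lambda>n. c (e n) * monomial (e n) x) sums g x"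
       "\<And>x. x \<in> polydisc s \<Longrightarrow> (g has_derivative (\<lambda>h. \<Sum>i\<in>UNIV. D i x * h $ i)) (at x within polydisc s)"
      by blast
    have "(g has_derivative (\<lambda>h. \<Sum>i\<in>UNIV. D i x * h $ i)) (at x)"
      using g(2)[OF x] at_within_open[OF x open_polydisc] by simp
    then show ?thesis
    proof (rule has_derivative_transform_within_open[OF _ open_polydisc x])
      show "g y = f y" if "y \<in> polydisc s" for y
        using g(1)[OF that] ce[OF that] by (rule sums_unique2)
    qed
  qed
  show thesis using that 1 2 by blast
qed

section \<open>The Legendre transform\<close>

text \<open>
  The bilinear (not sesquilinear) pairing, so that \<open>pairing (gradient f x)\<close> is the complex differential
  of \<open>f\<close> at \<open>x\<close>.
\<close>

definition pairing :: "complex^'n \<Rightarrow> complex^'n \<Rightarrow> complex"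
  where "pairing x y = (\<Sum>i\<in>UNIV. x $ i * y $ i)"

lemma norm_pairing_le: "norm (pairing x y) \<le> norm x * norm y"
proof -
  have "norm (pairing x y) \<le> (\<Sum>i\<in>UNIV. \<bar>norm (x $ i)\<bar> * \<bar>norm (y $ i)\<bar>)"
    unfolding pairing_def by (rule order_trans[OF norm_sum]) (simp add: norm_mult)
  also have "\<dots> \<le> norm x * norm y"
    unfolding norm_vec_def by (rule L2_set_mult_ineq)
  finally show ?thesis .
qed

lemma bounded_bilinear_pairing: "bounded_bilinear pairing"
proof
  show "\<exists>K. \<forall>x y. norm (pairing x y :: complex) \<le> norm (x :: complex^'n) * norm y * K"
    by (rule exI[of _ 1]) (simp add: norm_pairing_le)
qed (simp_all add: pairing_def algebra_simps sum.distrib scaleR_sum_right)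

lemma has_derivative_vecI:
  fixes f :: "'a::real_normed_vector \<Rightarrow> 'b::real_normed_vector^'n"
  assumes "\<And>i. ((\<lambda>x. f x $ i) has_derivative (\<lambda>h. f' h $ i)) F"
  shows "(f has_derivative f') F"
proof -
  have ax: "bounded_linear (axis i :: 'b \<Rightarrow> 'b^'n)" for i
  proof
    show "\<exists>K. \<forall>x. norm (axis i x :: 'b^'n) \<le> norm (x :: 'b) * K"
      by (rule exI[of _ 1])
         (simp add: norm_vec_def L2_set_def axis_def if_distrib[of norm] if_distrib[of "\<lambda>z. z\<^sup>2"] cong: if_cong)
  qed (auto simp: axis_def vec_eq_iff)
  have eq: "(\<Sum>i\<in>UNIV. axis i (v $ i)) = v" for v :: "'b^'n"
    by (simp add: vec_eq_iff axis_def sum.delta' if_distrib cong: if_cong)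
  have "((\<lambda>x. \<Sum>i\<in>UNIV. axis i (f x $ i)) has_derivative (\<lambda>h. \<Sum>i\<in>UNIV. axis i (f' h $ i))) F"
    by (intro has_derivative_sum bounded_linear.has_derivative[OF ax] assms)
  then show ?thesis by (simp add: eq)
qed

lemma differentiable_vecI:
  fixes f :: "'a::real_normed_vector \<Rightarrow> 'b::real_normed_vector^'n"
  assumes "\<And>i. (\<lambda>x. f x $ i) differentiable F"
  shows "f differentiable F"
proof -
  from assms obtain f' where "\<And>i. ((\<lambda>x. f x $ i) has_derivative f' i) F"
    unfolding differentiable_def by metis
  then have "(f has_derivative (\<lambda>h. \<chi> i. f' i h)) F"
    by (intro has_derivative_vecI) simp
  then show ?thesis unfolding differentiable_def by blast
qed

text \<open>
  The Legendre transform of \<open>f\<close>, written as a function of the point \<open>x\<close> and not of the covector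
  \<open>F x\<close>, because \<open>F\<close> need not be injective. It is used with \<open>F\<close> the gradient of \<open>f\<close>.
\<close>

definition legendre :: "(complex^'n \<Rightarrow> complex) \<Rightarrow> (complex^'n \<Rightarrow> complex^'n) \<Rightarrow> complex^'n \<Rightarrow> complex"
  where "legendre f F x = pairing x (F x) - f x"

text \<open>
  The terms containing \<open>h\<close> itself cancel. Thus, wherever \<open>F\<close> is a local coordinate, the
  derivative of the transform with respect to \<open>F\<close> is just \<open>x\<close>, which is bounded by the radius of the
  ball under consideration; \<open>f\<close> has no such bound near points where \<open>F\<close> degenerates.
\<close>

lemma has_derivative_legendre:
  assumes "(f has_derivative pairing (F x)) (at x)" "(F has_derivative J) (at x)"
  shows "(legendre f F has_derivative (\<lambda>h. pairing x (J h))) (at x)"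
proof -
  have comm: "pairing h (F x) = pairing (F x) h" for h
    by (simp add: pairing_def mult.commute)
  have "((\<lambda>x. pairing x (F x) - f x) has_derivative
      (\<lambda>h. pairing x (J h) + pairing h (F x) - pairing (F x) h)) (at x)"
    by (intro has_derivative_diff bounded_bilinear.FDERIV[OF bounded_bilinear_pairing] assms has_derivative_ident)
  then show ?thesis
    by (simp add: legendre_def[abs_def] comm)
qed

text \<open>
  Suppose that \<open>F\<close> is nondegenerate wherever it takes a value \<open>t y\<close> with \<open>0 < t \<le> 1\<close>. Moving the value of
  \<open>F\<close> from \<open>y\<close> to \<open>0\<close> along the segment then changes the transform at a rate of at most \<open>R * norm y\<close>, so
  one expects to arrive at a zero \<open>z\<close> of \<open>F\<close> satisfying the estimate. Instead of lifting the segment to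
  a path, one maximises a real part of the transform minus \<open>R * norm y * t\<close> over all pairs
  \<open>(x, t)\<close> with \<open>F x = t y\<close>: where \<open>t > 0\<close>, the local solvability of \<open>F x = t' y\<close> for \<open>t'\<close> slightly below
  \<open>t\<close> produces a larger value, so the maximum is attained at \<open>t = 0\<close>. The condition on the sphere keeps
  the competing points inside the ball.
\<close>

lemma legendre_ray_bound:
  fixes f :: "complex^'n \<Rightarrow> complex"
  assumes df: "\<And>x. x \<in> cball 0 R \<Longrightarrow> (f has_derivative pairing (F x)) (at x)"
    and dF: "\<And>x. x \<in> cball 0 R \<Longrightarrow> (F has_derivative J x) (at x)"
    and nondeg: "\<And>x t h. \<lbrakk>x \<in> cball 0 R; 0 < t; t \<le> 1; F x = t *\<^sub>R y; J x h = 0\<rbrakk> \<Longrightarrow> h = 0"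
    and sphere: "\<And>x. norm x = R \<Longrightarrow> norm y < norm (F x)"
    and w: "w \<in> cball 0 R" "F w = y"
  shows "\<exists>z\<in>cball 0 R. F z = 0 \<and> norm (legendre f F w) \<le> R * norm y + norm (legendre f F z)"
proof (cases "y = 0")
  case True
  then show ?thesis using w by (intro bexI[of _ w]) auto
next
  case False
  let ?L = "legendre f F"
  obtain c where c: "norm c = 1" "c * ?L w = of_real (norm (?L w))"
  proof (cases "?L w = 0")
    case True then show ?thesis using that[of 1] by simp
  next
    case False
    then show ?thesis
      using that[of "cnj (?L w) / of_real (norm (?L w))"]
      by (auto simp: norm_divide complex_norm_square[symmetric] power2_eq_square mult.commute[of "cnj _"])
  qed
  have dL: "(?L has_derivative (\<lambda>h. pairing x (J x h))) (at x)" if "x \<in> cball 0 R" for x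
    using has_derivative_legendre[OF df[OF that] dF[OF that]] .
  have contF: "continuous_on (cball 0 R) F" and contL: "continuous_on (cball 0 R) ?L"
    using dF dL by (meson continuous_at_imp_continuous_on has_derivative_continuous)+
  \<comment> \<open>the preimage of the segment from 0 to \<open>y\<close>\<close>
  define P where "P = {p \<in> cball 0 R \<times> {0..1::real}. F (fst p) - snd p *\<^sub>R y = 0}"
  have fst: "continuous_on (cball 0 R \<times> {0..1::real}) (\<lambda>p. g (fst p))"
    if "continuous_on (cball 0 R) g" for g :: "complex^'n \<Rightarrow> 'b::topological_space"
    by (rule continuous_on_compose2[OF that]) (auto intro: continuous_intros)
  have "closed P"
    unfolding P_def
    by (intro continuous_closed_preimage_constant closed_Times continuous_intros fst contF) auto
  then have "compact ((cball 0 R \<times> {0..1}) \<inter> P)"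
    by (intro compact_Int_closed compact_Times) auto
  moreover have "(cball 0 R \<times> {0..1}) \<inter> P = P" unfolding P_def by blast
  ultimately have "compact P" by simp
  define \<Phi> where "\<Phi> p = Re (c * ?L (fst p)) - R * norm y * snd p" for p
  have "continuous_on P \<Phi>"
    unfolding \<Phi>_def
    by (rule continuous_on_subset[of "cball 0 R \<times> {0..1}"])
       (auto simp: P_def intro!: continuous_intros fst contL)
  moreover have wP: "(w, 1) \<in> P" using w by (auto simp: P_def)
  ultimately obtain p where "p \<in> P" and p: "\<And>q. q \<in> P \<Longrightarrow> \<Phi> q \<le> \<Phi> p"
    using continuous_attains_sup[OF \<open>compact P\<close>] by blast
  obtain a t where pa: "p = (a, t)" by fastforce
  have a: "a \<in> cball 0 R" and t: "0 \<le> t" "t \<le> 1" and Fa: "F a = t *\<^sub>R y"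
    using \<open>p \<in> P\<close> by (auto simp: P_def pa)
  have "t = 0"
  proof (rule ccontr)
    assume "t \<noteq> 0"
    with t have "0 < t" by simp
    have "norm (F a) \<le> norm y" using t Fa by (simp add: mult_left_le_one_le)
    with sphere[of a] a have aR: "norm a < R" by force
    define j where "j = J a"
    have j: "(F has_derivative j) (at a)" using dF[OF a] by (simp add: j_def)
    then have "bounded_linear j" by (rule has_derivative_bounded_linear)
    then have "linear j" by (rule bounded_linear.linear)
    have "inj j"
      using nondeg[OF a \<open>0 < t\<close> t(2) Fa] \<open>linear j\<close> by (auto simp: j_def linear_injective_0)
    obtain b where b: "b > 0" "\<And>h. b * norm h \<le> norm (j h)"
      using linear_inj_bounded_below_pos[OF \<open>linear j\<close> \<open>inj j\<close>] by blast
    define \<eta> where "\<eta> = R - norm a"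
    have "\<eta> > 0" using aR by (simp add: \<eta>_def)
    \<comment> \<open>to first order at \<open>a\<close>, the transform depends on \<open>x\<close> only through \<open>F x\<close>; \<open>E\<close> is the error\<close>
    define E where "E x = ?L x - pairing a (F x)" for x
    have "(E has_derivative (\<lambda>h. pairing a (j h) - pairing a (j h))) (at a)"
      unfolding E_def
      by (intro has_derivative_diff bounded_linear.has_derivative[OF bounded_bilinear.bounded_linear_right[OF bounded_bilinear_pairing]] j)
         (use dL[OF a] in \<open>simp add: j_def\<close>)
    then have E: "(E has_derivative (\<lambda>h. 0)) (at a)" by simp
    \<comment> \<open>\<open>F\<close> expands by at least \<open>b / 2\<close> near \<open>a\<close>, so this makes the error at most \<open>\<eta> / 2\<close> times the change of \<open>F\<close>, while \<open>R\<close> exceeds \<open>norm a\<close> by \<open>\<eta>\<close>\<close>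
    define \<epsilon> where "\<epsilon> = b * \<eta> / 4"
    have "\<epsilon> > 0" using b \<open>\<eta> > 0\<close> by (simp add: \<epsilon>_def)
    from E \<open>\<epsilon> > 0\<close> obtain d1 where d1: "d1 > 0" "\<And>x. norm (x - a) < d1 \<Longrightarrow> norm (E x - E a) \<le> \<epsilon> * norm (x - a)"
      unfolding has_derivative_at_alt by force
    from j b obtain d2 where d2: "d2 > 0" "\<And>x. norm (x - a) < d2 \<Longrightarrow> norm (F x - F a - j (x - a)) \<le> b / 2 * norm (x - a)"
      unfolding has_derivative_at_alt by (metis half_gt_zero)
    have low: "b / 2 * norm (x - a) \<le> norm (F x - F a)" if "norm (x - a) < d2" for x
      using d2(2)[OF that] b(2)[of "x - a"] norm_triangle_ineq2[of "j (x - a)" "F x - F a"]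
      by (simp add: norm_minus_commute)
    define T where "T = ball a (min (min d1 d2) \<eta>)"
    have TR: "T \<subseteq> cball 0 R"
    proof
      fix x assume "x \<in> T"
      then have "norm (x - a) < \<eta>" by (simp add: T_def dist_norm norm_minus_commute)
      then show "x \<in> cball 0 R" using norm_triangle_sub[of x a] by (simp add: \<eta>_def)
    qed
    have "F a \<in> interior (F ` T)"
    proof (rule sussmann_open_mapping[where S = T and f' = j and g' = "inv j"])
      show "bounded_linear (inv j)"
        using inj_linear_imp_inv_bounded_linear \<open>bounded_linear j\<close> \<open>inj j\<close> by blast
      have "surj j" using linear_inj_imp_surj[OF \<open>linear j\<close> \<open>inj j\<close>] .
      then show "j \<circ> inv j = id" by (simp add: surj_iff)
      show "continuous_on T F" using contF TR continuous_on_subset by blast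
      show "a \<in> interior T" "a \<in> T" "open T"
        using d1 d2 \<open>\<eta> > 0\<close> by (auto simp: T_def)
    qed (use j in auto)
    then obtain r where r: "r > 0" "ball (F a) r \<subseteq> F ` T"
      by (auto simp: mem_interior)
    \<comment> \<open>at most half of the way from \<open>F a\<close> to the boundary of the ball of radius \<open>r\<close>, which lies in the image of \<open>T\<close>\<close>
    define \<tau> where "\<tau> = min t (r / (2 * norm y))"
    have \<tau>: "0 < \<tau>" "\<tau> \<le> t" using \<open>0 < t\<close> r False by (auto simp: \<tau>_def)
    have "\<tau> * norm y \<le> r / (2 * norm y) * norm y"
      by (intro mult_right_mono) (auto simp: \<tau>_def)
    also have "\<dots> < r" using r False by simp
    finally have "F a - \<tau> *\<^sub>R y \<in> ball (F a) r" using \<tau> by (simp add: dist_norm)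
    then have "F a - \<tau> *\<^sub>R y \<in> F ` T" using r(2) by blast
    then obtain x where x: "x \<in> T" "F x = F a - \<tau> *\<^sub>R y" by (metis imageE)
    have xa: "norm (x - a) < d1" "norm (x - a) < d2"
      using x by (auto simp: T_def dist_norm norm_minus_commute)
    have "(x, t - \<tau>) \<in> P"
      using x TR t \<tau> Fa by (auto simp: P_def algebra_simps)
    from p[OF this] have le: "Re (c * (?L x - ?L a)) + R * norm y * \<tau> \<le> 0"
      by (simp add: \<Phi>_def pa algebra_simps)
    have "norm (E x - E a) \<le> \<epsilon> * norm (x - a)" by (rule d1(2)[OF xa(1)])
    also have "\<dots> = \<eta> / 2 * (b / 2 * norm (x - a))" by (simp add: \<epsilon>_def)
    also have "\<dots> \<le> \<eta> / 2 * norm (F x - F a)"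
      using low[OF xa(2)] \<open>\<eta> > 0\<close> by (intro mult_left_mono) auto
    also have "norm (F x - F a) = \<tau> * norm y" using x \<tau> by simp
    finally have Ex: "norm (E x - E a) \<le> \<eta> / 2 * (\<tau> * norm y)" .
    have "norm (?L x - ?L a) = norm ((E x - E a) + pairing a (F x - F a))"
      by (simp add: E_def bounded_bilinear.diff_right[OF bounded_bilinear_pairing])
    also have "\<dots> \<le> \<eta> / 2 * (\<tau> * norm y) + norm a * norm (F x - F a)"
      by (intro norm_triangle_le add_mono Ex norm_pairing_le)
    also have "norm (F x - F a) = \<tau> * norm y" using x \<tau> by simp
    finally have "norm (?L x - ?L a) \<le> (\<eta> / 2 + norm a) * (\<tau> * norm y)"
      by (simp add: algebra_simps)
    also have "\<dots> < R * (\<tau> * norm y)"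
      using \<open>\<eta> > 0\<close> \<tau> False by (intro mult_strict_right_mono) (auto simp: \<eta>_def field_simps)
    finally have "norm (c * (?L x - ?L a)) < R * (\<tau> * norm y)"
      by (simp add: norm_mult c)
    moreover have "- Re (c * (?L x - ?L a)) \<le> norm (c * (?L x - ?L a))"
      using abs_Re_le_cmod[of "c * (?L x - ?L a)"] by linarith
    ultimately show False using le by (simp add: algebra_simps)
  qed
  have "norm (?L w) - R * norm y = \<Phi> (w, 1)" by (simp add: \<Phi>_def c)
  also have "\<dots> \<le> \<Phi> (a, 0)" using p[OF wP] by (simp add: pa \<open>t = 0\<close>)
  also have "\<dots> \<le> norm (c * ?L a)" unfolding \<Phi>_def using complex_Re_le_cmod[of "c * ?L a"] by simp
  also have "\<dots> = norm (?L a)" by (simp add: norm_mult c)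
  finally show ?thesis using a Fa \<open>t = 0\<close> by (intro bexI[of _ a]) auto
qed

section \<open>Generic diagonal perturbations\<close>

lemma norm_times_vec_le: "norm (d * x) \<le> norm d * norm (x :: complex^'n)"
proof -
  have "norm (d * x) \<le> norm (norm d *\<^sub>R x)"
    by (rule norm_le_componentwise_cart)
       (auto simp: norm_mult intro!: mult_right_mono Finite_Cartesian_Product.norm_nth_le)
  then show ?thesis by simp
qed

lemma bounded_bilinear_times_vec:
  "bounded_bilinear (\<lambda>(x :: complex^'n) (y :: complex^'n). x * y)"
proof
  show "\<exists>K. \<forall>x y. norm (x * y) \<le> norm (x :: complex^'n) * norm (y :: complex^'n) * K"
    by (rule exI[of _ 1]) (simp add: norm_times_vec_le)
qed (simp_all add: vec_eq_iff algebra_simps)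

text \<open>
  Products of vectors are componentwise, so \<open>v \<mapsto> A *v v + d * v\<close> is \<open>A\<close> with \<open>d\<close> added to its
  diagonal: if \<open>A\<close> is the Hessian of \<open>f\<close>, the Hessian of \<open>f\<close> plus the quadratic form with
  coefficients \<open>d $ i / 2\<close>.
\<close>

definition degenerate_shift :: "complex^'n^'n \<Rightarrow> complex^'n \<Rightarrow> bool"
  where "degenerate_shift A d \<longleftrightarrow> (\<exists>v. v \<noteq> 0 \<and> A *v v + d * v = 0)"

text \<open>
  A dimension count, which replaces a theorem of Sard type. Sort the pairs \<open>(x, d)\<close> by the support \<open>I\<close> of a
  kernel vector \<open>v\<close>, normalised to \<open>v $ i = 1\<close> for some \<open>i \<in> I\<close>. The kernel equation determines \<open>d $ j\<close> for
  \<open>j \<in> I\<close> from \<open>x\<close> and \<open>v\<close>, while \<open>d $ j\<close> is free for \<open>j \<notin> I\<close>. Hence \<open>x\<close>, the entries \<open>v $ j\<close> with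
  \<open>j \<in> I - {i}\<close>, the entries \<open>d $ j\<close> with \<open>j \<notin> I\<close>, and the real number \<open>t\<close> parametrise everything. They
  fit into two vectors \<open>x\<close> and \<open>N\<close> whose entry \<open>N $ i\<close> carries only the real number \<open>t\<close>, and a
  differentiable image of the real hyperplane \<open>Im (N $ i) = 0\<close> is negligible.
\<close>

lemma negligible_degenerate:
  fixes H :: "complex^'n \<Rightarrow> complex^'n^'n" and G :: "complex^'n \<Rightarrow> complex^'n \<Rightarrow> real \<Rightarrow> complex^'n"
  assumes H: "\<And>x i j. x \<in> X \<Longrightarrow> (\<lambda>x. H x $ i $ j) differentiable (at x)"
    and G: "\<And>d x t. x \<in> X \<Longrightarrow> (\<lambda>(d, x, t). G d x t) differentiable (at (d, x, t))"
  shows "negligible {(d, G d x t) | d x t. x \<in> X \<and> degenerate_shift (H x) d}"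
proof -
  define v :: "'n set \<Rightarrow> 'n \<Rightarrow> complex^'n \<Rightarrow> complex^'n"
    where "v I i N = (\<chi> j. if j = i then 1 else if j \<in> I then N $ j else 0)" for I i N
  define \<delta> where "\<delta> I i p = (\<chi> j. if j \<in> I then - (H (fst p) *v v I i (snd p)) $ j / v I i (snd p) $ j
      else snd p $ j)" for I i and p :: "(complex^'n) \<times> (complex^'n)"
  define T where "T I i p = (\<delta> I i p, G (\<delta> I i p) (fst p) (Re (snd p $ i)))" for I i p
  define S :: "'n set \<Rightarrow> 'n \<Rightarrow> ((complex^'n) \<times> (complex^'n)) set"
    where "S I i = {(x, N). x \<in> X \<and> Im (N $ i) = 0 \<and> (\<forall>j\<in>I. j \<noteq> i \<longrightarrow> N $ j \<noteq> 0)}" for I i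
  have nth: "(\<lambda>p. snd p $ j) differentiable (at p)" for j and p :: "(complex^'n) \<times> (complex^'n)"
    by (rule bounded_linear_imp_differentiable)
       (rule bounded_linear_compose[OF bounded_linear_vec_nth bounded_linear_snd])
  have negS: "negligible (S I i)" for I i
  proof (rule negligible_subset)
    show "negligible {p. (0 :: complex^'n, axis i \<i> :: complex^'n) \<bullet> p = 0}"
      by (rule negligible_hyperplane) (auto simp: zero_prod_def axis_eq_0_iff)
    show "S I i \<subseteq> {p. (0 :: complex^'n, axis i \<i> :: complex^'n) \<bullet> p = 0}"
      by (auto simp: S_def inner_axis' inner_complex_def)
  qed
  have vnth: "(\<lambda>p. v I i (snd p) $ j) differentiable (at p)"
    for I i j and p :: "(complex^'n) \<times> (complex^'n)"
    by (cases "j = i"; cases "j \<in> I") (simp_all add: v_def nth)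
  have dT: "T I i differentiable (at p)" if "p \<in> S I i" for I i p
  proof -
    have X: "fst p \<in> X" and nz: "j \<in> I \<Longrightarrow> v I i (snd p) $ j \<noteq> 0" for j
      using that by (auto simp: S_def v_def)
    have "(\<lambda>p. H (fst p) $ j $ k) differentiable (at p)" for j k
      by (rule differentiable_compose[where f = "\<lambda>x. H x $ j $ k" and g = fst])
         (simp_all add: H X bounded_linear_imp_differentiable bounded_linear_fst)
    then have "(\<lambda>p. \<delta> I i p $ j) differentiable (at p)" for j
      by (cases "j \<in> I") (auto simp: \<delta>_def matrix_vector_mult_def nth vnth nz
        intro!: differentiable_divide differentiable_minus differentiable_sum differentiable_mult)
    then have \<delta>: "\<delta> I i differentiable (at p)" by (rule differentiable_vecI)
    have "(\<lambda>p. (\<delta> I i p, fst p, Re (snd p $ i))) differentiable (at p)"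
      using \<delta> bounded_linear_imp_differentiable[OF bounded_linear_compose[OF bounded_linear_Re
        bounded_linear_compose[OF bounded_linear_vec_nth bounded_linear_snd]]]
      by (intro differentiable_Pair) (auto simp: bounded_linear_imp_differentiable bounded_linear_fst)
    then have "(\<lambda>p. (\<lambda>(d, x, t). G d x t) (\<delta> I i p, fst p, Re (snd p $ i))) differentiable (at p)"
      by (rule differentiable_compose[rotated]) (rule G[OF X])
    then show ?thesis
      unfolding T_def using \<delta> by (intro differentiable_Pair) auto
  qed
  have "negligible (T I i ` S I i)" for I i
    by (rule negligible_differentiable_image_negligible[OF _ negS])
       (auto simp: differentiable_on_def intro: dT differentiable_at_withinI)
  then have neg: "negligible (\<Union>(I, i)\<in>UNIV. T I i ` S I i)"
    by (intro negligible_Union) auto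
  moreover have "{(d, G d x t) | d x t. x \<in> X \<and> degenerate_shift (H x) d} \<subseteq> (\<Union>(I, i)\<in>UNIV. T I i ` S I i)"
  proof clarify
    fix d x t assume x: "x \<in> X" and deg: "degenerate_shift (H x) d"
    from deg obtain u where u: "u \<noteq> 0" "H x *v u + d * u = 0"
      by (auto simp: degenerate_shift_def)
    from u obtain i where i: "u $ i \<noteq> 0" by (auto simp: vec_eq_iff)
    define w where "w = (\<chi> j. u $ j / u $ i)"
    have "H x *v w + d * w = inverse (u $ i) *s (H x *v u + d * u)"
      by (simp add: w_def vec_eq_iff matrix_vector_mult_def sum_distrib_left field_simps)
    then have w: "(H x *v w) $ j + d $ j * w $ j = 0" for j
      using u by (simp add: vec_eq_iff) 
    have wi: "w $ i = 1" using i by (simp add: w_def)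
    define I where "I = {j. w $ j \<noteq> 0}"
    define N where "N = (\<chi> j. if j = i then of_real t else if j \<in> I then w $ j else d $ j)"
    have vN: "v I i N = w" by (auto simp: v_def N_def vec_eq_iff I_def wi)
    have "\<delta> I i (x, N) $ j = d $ j" for j
    proof (cases "j \<in> I")
      case True
      then have "d $ j = - (H x *v w) $ j / w $ j"
        using w[of j] by (simp add: I_def field_simps add_eq_0_iff)
      then show ?thesis using True by (simp add: \<delta>_def vN)
    next
      case False
      then have "j \<noteq> i" using wi by (auto simp: I_def)
      then show ?thesis using False by (simp add: \<delta>_def N_def)
    qed
    then have "\<delta> I i (x, N) = d" by (simp add: vec_eq_iff)
    then have "T I i (x, N) = (d, G d x t)" by (simp add: T_def N_def)
    moreover have "(x, N) \<in> S I i" using x by (auto simp: S_def N_def I_def)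
    ultimately show "(d, G d x t) \<in> (\<Union>(I, i)\<in>UNIV. T I i ` S I i)"
      by (metis (no_types, lifting) UN_iff UNIV_I case_prod_conv image_eqI)
  qed
  ultimately show ?thesis by (rule negligible_subset)
qed

text \<open>
  By the dimension count, the pairs \<open>(d, y)\<close> for which \<open>F x + d * x\<close>, scaled by a real factor, equals
  \<open>y\<close> at some degenerate point \<open>x\<close> are too few to contain an open set. Since \<open>y\<close> must be the image of a point
  \<open>w'\<close> near \<open>w\<close>, one also needs that the images of nearby pairs \<open>(d, w')\<close> fill an open set. This holds
  around any pair that is itself nondegenerate, and such pairs exist by the same count.
\<close>

lemma regular_perturbation_exists:
  fixes F :: "complex^'n \<Rightarrow> complex^'n"
  assumes dF: "\<And>x. x \<in> cball 0 R \<Longrightarrow> (F has_derivative (\<lambda>h. H x *v h)) (at x)"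
    and dH: "\<And>x i j. x \<in> cball 0 R \<Longrightarrow> (\<lambda>x. H x $ i $ j) differentiable (at x)"
    and w: "w \<in> ball 0 R" and "0 < e"
  shows "\<exists>d w'. norm d < e \<and> dist w w' < e \<and> w' \<in> ball 0 R \<and>
    (\<forall>x\<in>cball 0 R. \<forall>t::real. F w' + d * w' = t *\<^sub>R (F x + d * x) \<longrightarrow> \<not> degenerate_shift (H x) d)"
proof -
  define W where "W = ball (0 :: complex^'n) e \<times> (ball w e \<inter> ball 0 R)"
  have W: "open W" "(0, w) \<in> W"
    using w \<open>0 < e\<close> by (auto simp: W_def intro!: open_Times)
  have times: "(\<lambda>p. fst p * g p) differentiable (at (q :: (complex^'n) \<times> 'b))"
    if "g differentiable (at q)" for g :: "(complex^'n) \<times> 'b::real_normed_vector \<Rightarrow> complex^'n" and q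
    using that bounded_bilinear.FDERIV[OF bounded_bilinear_times_vec bounded_linear.has_derivative[OF bounded_linear_fst has_derivative_ident]]
    unfolding differentiable_def by blast
  have "negligible {(d, x) | d x (t::real). x \<in> cball 0 R \<and> degenerate_shift (H x) d}"
    by (rule negligible_degenerate[where G = "\<lambda>d x t. x", OF dH])
       (auto simp: case_prod_unfold intro!: bounded_linear_imp_differentiable bounded_linear_compose[OF bounded_linear_fst bounded_linear_snd])
  then have "\<not> W \<subseteq> {(d, x) | d x (t::real). x \<in> cball 0 R \<and> degenerate_shift (H x) d}"
    using open_not_negligible[OF W(1)] W(2) negligible_subset by blast
  then obtain d\<^sub>0 x\<^sub>0 where p0: "(d\<^sub>0, x\<^sub>0) \<in> W" "\<not> (x\<^sub>0 \<in> cball 0 R \<and> degenerate_shift (H x\<^sub>0) d\<^sub>0)"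
    by auto
  then have x0: "x\<^sub>0 \<in> cball 0 R" and nd: "\<not> degenerate_shift (H x\<^sub>0) d\<^sub>0"
    by (auto simp: W_def)
  define \<Psi> where "\<Psi> p = (fst p, F (snd p) + fst p * snd p)" for p :: "(complex^'n) \<times> (complex^'n)"
  define \<Psi>' where "\<Psi>' p h = (fst h, H (snd p) *v snd h + (fst p * snd h + fst h * snd p))"
    for p h :: "(complex^'n) \<times> (complex^'n)"
  have d\<Psi>: "(\<Psi> has_derivative \<Psi>' p) (at p)" if "p \<in> W" for p
  proof -
    have "snd p \<in> cball 0 R" using that by (auto simp: W_def)
    from has_derivative_compose[OF bounded_linear.has_derivative[OF bounded_linear_snd has_derivative_ident] dF[OF this]]
    have "((\<lambda>p. F (snd p)) has_derivative (\<lambda>h. H (snd p) *v snd h)) (at p)" .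
    then show ?thesis
      unfolding \<Psi>_def \<Psi>'_def
      by (intro has_derivative_Pair has_derivative_add bounded_bilinear.FDERIV[OF bounded_bilinear_times_vec]
           bounded_linear.has_derivative[OF bounded_linear_fst] bounded_linear.has_derivative[OF bounded_linear_snd] has_derivative_ident)
  qed
  let ?j = "\<Psi>' (d\<^sub>0, x\<^sub>0)"
  have bl: "bounded_linear ?j" using d\<Psi>[OF p0(1)] by (rule has_derivative_bounded_linear)
  have lin: "linear ?j" using bl by (rule bounded_linear.linear)
  have "h = 0" if "?j h = 0" for h
    using that nd by (cases h) (auto simp: \<Psi>'_def degenerate_shift_def zero_prod_def)
  then have inj: "inj ?j" using lin by (auto simp: linear_injective_0)
  have "\<Psi> (d\<^sub>0, x\<^sub>0) \<in> interior (\<Psi> ` W)"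
  proof (rule sussmann_open_mapping[where S = W and f' = ?j and g' = "inv ?j"])
    show "bounded_linear (inv ?j)" using inj_linear_imp_inv_bounded_linear bl inj by blast
    have "surj ?j" using linear_inj_imp_surj[OF lin inj] .
    then show "?j \<circ> inv ?j = id" by (simp add: surj_iff)
    show "continuous_on W \<Psi>"
      using d\<Psi> by (meson continuous_at_imp_continuous_on has_derivative_continuous)
    show "(d\<^sub>0, x\<^sub>0) \<in> interior W" using p0 W by (simp add: interior_open)
  qed (use p0 W d\<Psi>[OF p0(1)] in auto)
  then have "\<not> negligible (interior (\<Psi> ` W))"
    by (intro open_not_negligible) auto
  moreover have "negligible {(d, t *\<^sub>R (F x + d * x)) | d x t. x \<in> cball 0 R \<and> degenerate_shift (H x) d}"
  proof (rule negligible_degenerate[where G = "\<lambda>d x t. t *\<^sub>R (F x + d * x)", OF dH])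
    fix d x :: "complex^'n" and t :: real assume x: "x \<in> cball 0 R"
    have snd: "bounded_linear (\<lambda>p :: (complex^'n) \<times> (complex^'n) \<times> real. fst (snd p))"
      by (rule bounded_linear_compose[OF bounded_linear_fst bounded_linear_snd])
    have "F differentiable (at x)" using dF[OF x] by (auto simp: differentiable_def)
    then have "(\<lambda>p :: (complex^'n) \<times> (complex^'n) \<times> real. F (fst (snd p))) differentiable (at (d, x, t))"
      using differentiable_compose[where f = F and g = "\<lambda>p. fst (snd p)", OF _ bounded_linear_imp_differentiable[OF snd]]
      by simp
    then show "(\<lambda>(d, x, t). t *\<^sub>R (F x + d * x)) differentiable (at (d, x, t))"
      unfolding case_prod_unfold
      by (intro differentiable_scaleR differentiable_add times bounded_linear_imp_differentiable[OF snd]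
          bounded_linear_imp_differentiable[OF bounded_linear_compose[OF bounded_linear_snd bounded_linear_snd]])
  qed
  ultimately obtain q where q: "q \<in> interior (\<Psi> ` W)"
      "q \<notin> {(d, t *\<^sub>R (F x + d * x)) | d x t. x \<in> cball 0 R \<and> degenerate_shift (H x) d}"
    using negligible_subset by blast
  then obtain d w' where "q = \<Psi> (d, w')" and dw: "(d, w') \<in> W"
    using interior_subset by (metis (no_types, lifting) imageE subsetD surj_pair)
  with q have "\<forall>x\<in>cball 0 R. \<forall>t::real. F w' + d * w' = t *\<^sub>R (F x + d * x) \<longrightarrow> \<not> degenerate_shift (H x) d"
    by (auto simp: \<Psi>_def)
  with dw show ?thesis by (auto simp: W_def)
qed

section \<open>The gradient inequality for an isolated singularity\<close>

text \<open>
  Perturb \<open>f\<close> by a small diagonal quadratic form so that the ray bound applies at a point near \<open>w\<close>, and let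
  the perturbation tend to 0. The perturbed gradient may have several zeros, but they
  tend to the only zero 0 of \<open>F\<close>, where the transform vanishes. The perturbation is needed because
  the Hessian \<open>H\<close> may be singular at points where \<open>F\<close> takes values on the segment from 0 to \<open>F w\<close>.
\<close>

lemma legendre_le_gradient:
  fixes f :: "complex^'n \<Rightarrow> complex"
  assumes "0 < R"
    and df: "\<And>x. x \<in> cball 0 R \<Longrightarrow> (f has_derivative pairing (F x)) (at x)"
    and dF: "\<And>x. x \<in> cball 0 R \<Longrightarrow> (F has_derivative (\<lambda>h. H x *v h)) (at x)"
    and dH: "\<And>x i j. x \<in> cball 0 R \<Longrightarrow> (\<lambda>x. H x $ i $ j) differentiable (at x)"
    and F0: "\<And>x. x \<in> cball 0 R \<Longrightarrow> F x = 0 \<Longrightarrow> x = 0" and "f 0 = 0"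
    and w: "w \<in> ball 0 R" and sphere: "\<And>x. norm x = R \<Longrightarrow> norm (F w) < norm (F x)"
  shows "norm (legendre f F w) \<le> R * norm (F w)"
proof -
  let ?L = "legendre f F"
  have dL: "(?L has_derivative (\<lambda>h. pairing x (H x *v h))) (at x)" if "x \<in> cball 0 R" for x
    using has_derivative_legendre[OF df[OF that] dF[OF that]] .
  have contF: "continuous_on (cball 0 R) F" and contL: "continuous_on (cball 0 R) ?L"
    using dF dL by (meson continuous_at_imp_continuous_on has_derivative_continuous)+
  have L0: "?L 0 = 0" using \<open>f 0 = 0\<close> by (simp add: legendre_def pairing_def)
  obtain x\<^sub>1 where x1: "x\<^sub>1 \<in> sphere 0 R" "\<And>x. x \<in> sphere 0 R \<Longrightarrow> norm (F x\<^sub>1) \<le> norm (F x)"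
  proof -
    have "sphere (0 :: complex^'n) R \<noteq> {}" using \<open>0 < R\<close> by simp
    moreover have "continuous_on (sphere 0 R) (\<lambda>x. norm (F x))"
      by (intro continuous_on_norm continuous_on_subset[OF contF]) auto
    ultimately show thesis using continuous_attains_inf[OF compact_sphere] that by blast
  qed
  define m where "m = norm (F x\<^sub>1)"
  have mw: "norm (F w) < m" using sphere x1 by (simp add: m_def)
  have "\<forall>n. \<exists>d w'. norm d < 1 / Suc n \<and> dist w w' < 1 / Suc n \<and> w' \<in> ball 0 R \<and>
    (\<forall>x\<in>cball 0 R. \<forall>t::real. F w' + d * w' = t *\<^sub>R (F x + d * x) \<longrightarrow> \<not> degenerate_shift (H x) d)"
    by (intro allI regular_perturbation_exists dF dH w) auto
  then obtain d u where d: "\<And>n. norm (d n) < 1 / Suc n" and u: "\<And>n. dist w (u n) < 1 / Suc n"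
    and uR: "\<And>n. u n \<in> ball 0 R"
    and reg: "\<And>n x (t::real). x \<in> cball 0 R \<Longrightarrow> F (u n) + d n * u n = t *\<^sub>R (F x + d n * x) \<Longrightarrow>
        \<not> degenerate_shift (H x) (d n)"
    by metis
  have d0: "d \<longlonglongrightarrow> 0"
    by (rule tendsto_norm_zero_cancel, rule tendsto_sandwich[OF _ _ tendsto_const LIMSEQ_Suc[OF lim_1_over_n]])
       (use d in \<open>auto intro!: always_eventually simp del: of_nat_Suc intro: less_imp_le\<close>)
  have "(\<lambda>n. dist (u n) w) \<longlonglongrightarrow> 0"
    by (rule tendsto_sandwich[OF _ _ tendsto_const LIMSEQ_Suc[OF lim_1_over_n]])
       (use u in \<open>auto intro!: always_eventually simp: dist_commute simp del: of_nat_Suc intro: less_imp_le\<close>)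
  then have uw: "u \<longlonglongrightarrow> w" by (rule tendsto_dist_iff[THEN iffD2])
  have "w \<in> cball 0 R" using w by simp
  then have Fw: "isCont F w" and Lw: "isCont ?L w"
    by (rule has_derivative_continuous[OF dF], rule has_derivative_continuous[OF dL])
  have Fu: "(\<lambda>n. F (u n)) \<longlonglongrightarrow> F w" and Lu: "(\<lambda>n. ?L (u n)) \<longlonglongrightarrow> ?L w"
    by (rule isCont_tendsto_compose[OF Fw uw], rule isCont_tendsto_compose[OF Lw uw])
  define y where "y n = F (u n) + d n * u n" for n
  have "(\<lambda>n. d n * u n) \<longlonglongrightarrow> 0 * w"
    by (rule bounded_bilinear.tendsto[OF bounded_bilinear_times_vec d0 uw])
  then have y: "y \<longlonglongrightarrow> F w"
    using tendsto_add[OF Fu, of "\<lambda>n. d n * u n" "0 * w"]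
    by (simp add: y_def[abs_def] bounded_bilinear.zero_left[OF bounded_bilinear_times_vec])
  have "(\<lambda>n. norm (y n) + norm (d n) * R) \<longlonglongrightarrow> norm (F w) + norm (0 :: complex^'n) * R"
    by (intro tendsto_intros y d0)
  then have ev: "\<forall>\<^sub>F n in sequentially. norm (y n) + norm (d n) * R < m"
    using mw by (intro order_tendstoD(2)) simp_all
  have L_pert: "legendre (\<lambda>x. f x + pairing x (\<delta> * x) / 2) (\<lambda>x. F x + \<delta> * x) x = ?L x + pairing x (\<delta> * x) / 2" for \<delta> x
    by (simp add: legendre_def bounded_bilinear.add_right[OF bounded_bilinear_pairing])
  have pert_le: "norm (pairing x (\<delta> * x) / 2) \<le> R\<^sup>2 / 2 * norm \<delta>" if "x \<in> cball 0 R" for \<delta> x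
  proof -
    have "norm (pairing x (\<delta> * x)) \<le> norm x * (norm \<delta> * norm x)"
      by (intro order_trans[OF norm_pairing_le] mult_left_mono norm_times_vec_le) auto
    also have "\<dots> \<le> R * (norm \<delta> * R)" using that \<open>0 < R\<close> by (intro mult_mono) auto
    finally show ?thesis by (simp add: norm_divide power2_eq_square mult_ac)
  qed
  have bound: "\<forall>\<^sub>F n in sequentially. \<exists>z\<in>cball 0 R. norm (F z) \<le> norm (d n) * R \<and>
      norm (?L (u n)) \<le> R * norm (y n) + R\<^sup>2 * norm (d n) + norm (?L z)"
    using ev
  proof eventually_elim
    case (elim n)
    define \<delta> where "\<delta> = d n"
    let ?f = "\<lambda>x. f x + pairing x (\<delta> * x) / 2" and ?F = "\<lambda>x. F x + \<delta> * x"
    have "\<exists>z\<in>cball 0 R. ?F z = 0 \<and> norm (legendre ?f ?F (u n)) \<le> R * norm (y n) + norm (legendre ?f ?F z)"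
    proof (rule legendre_ray_bound)
      fix x :: "complex^'n" assume x: "x \<in> cball 0 R"
      have \<delta>x: "((\<lambda>x. \<delta> * x) has_derivative (\<lambda>h. \<delta> * h)) (at x)"
        by (rule bounded_linear.has_derivative[OF bounded_bilinear.bounded_linear_right[OF bounded_bilinear_times_vec] has_derivative_ident])
      then show "(?F has_derivative (\<lambda>h. H x *v h + \<delta> * h)) (at x)"
        by (intro has_derivative_add dF x)
      have "(?f has_derivative (\<lambda>h. pairing (F x) h + (pairing x (\<delta> * h) + pairing h (\<delta> * x)) / 2)) (at x)"
        by (intro has_derivative_add df x bounded_linear.has_derivative[OF bounded_linear_divide] bounded_bilinear.FDERIV[OF bounded_bilinear_pairing has_derivative_ident \<delta>x])
      moreover have "(\<lambda>h. pairing (F x) h + (pairing x (\<delta> * h) + pairing h (\<delta> * x)) / 2) = pairing (?F x)"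
      proof
        fix h
        have "pairing h (\<delta> * x) = pairing x (\<delta> * h)" "pairing x (\<delta> * h) = pairing (\<delta> * x) h"
          by (simp_all add: pairing_def mult_ac)
        then show "pairing (F x) h + (pairing x (\<delta> * h) + pairing h (\<delta> * x)) / 2 = pairing (?F x) h"
          by (simp add: bounded_bilinear.add_left[OF bounded_bilinear_pairing])
      qed
      ultimately show "(?f has_derivative pairing (?F x)) (at x)" by (simp only:)
    next
      fix x h :: "complex^'n" and t :: real
      assume x: "x \<in> cball 0 R" and t: "0 < t" "t \<le> 1" and eq: "F x + \<delta> * x = t *\<^sub>R y n" and h: "H x *v h + \<delta> * h = 0"
      have "y n = (1 / t) *\<^sub>R (F x + \<delta> * x)" using eq t by simp
      then have "\<not> degenerate_shift (H x) \<delta>" using reg[OF x, of n "1 / t"] by (simp add: y_def \<delta>_def)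
      then show "h = 0" using h by (auto simp: degenerate_shift_def)
    next
      fix x :: "complex^'n" assume x: "norm x = R"
      have "m \<le> norm (F x)" using x1 x by (simp add: m_def)
      moreover have "norm (F x) \<le> norm (F x + \<delta> * x) + norm (\<delta> * x)"
        by (metis add_diff_cancel_right' norm_triangle_ineq4)
      moreover have "norm (\<delta> * x) \<le> norm (d n) * R" using norm_times_vec_le[of \<delta> x] x by (simp add: \<delta>_def)
      ultimately show "norm (y n) < norm (F x + \<delta> * x)" using elim by linarith
    qed (use uR[of n] in \<open>auto simp: y_def \<delta>_def\<close>)
    then obtain z where z: "z \<in> cball 0 R" "F z + \<delta> * z = 0"
        and le: "norm (?L (u n) + pairing (u n) (\<delta> * u n) / 2) \<le> R * norm (y n) + norm (?L z + pairing z (\<delta> * z) / 2)"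
      unfolding L_pert by blast
    have "norm (F z) = norm (\<delta> * z)" using z(2) by (metis add_eq_0_iff norm_minus_cancel)
    also have "\<dots> \<le> norm \<delta> * R"
      using z(1) by (intro order_trans[OF norm_times_vec_le] mult_left_mono) auto
    finally have "norm (F z) \<le> norm (d n) * R" by (simp add: \<delta>_def)
    moreover have "norm (?L (u n)) \<le> norm (?L (u n) + pairing (u n) (\<delta> * u n) / 2) + norm (pairing (u n) (\<delta> * u n) / 2)"
      by (metis add_diff_cancel_right' norm_triangle_ineq4)
    moreover have "norm (?L z + pairing z (\<delta> * z) / 2) \<le> norm (?L z) + norm (pairing z (\<delta> * z) / 2)"
      by (rule norm_triangle_ineq)
    moreover have "norm (pairing z (\<delta> * z) / 2) \<le> R\<^sup>2 / 2 * norm \<delta>" using z by (intro pert_le)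
    moreover have "norm (pairing (u n) (\<delta> * u n) / 2) \<le> R\<^sup>2 / 2 * norm \<delta>"
      using uR[of n] by (intro pert_le) auto
    ultimately have "norm (?L (u n)) \<le> R * norm (y n) + R\<^sup>2 * norm (d n) + norm (?L z)"
      using le unfolding \<delta>_def by argo
    with \<open>norm (F z) \<le> norm (d n) * R\<close> z(1) show ?case by blast
  qed
  show ?thesis
  proof (rule field_le_epsilon)
    fix \<epsilon> :: real assume "0 < \<epsilon>"
    \<comment> \<open>away from its zero, \<open>F\<close> is bounded below, so a small value of \<open>F\<close> forces a small transform\<close>
    define K where "K = {x \<in> cball 0 R. \<epsilon> \<le> norm (?L x)}"
    obtain \<mu> where \<mu>: "\<mu> > 0" "\<And>x. x \<in> K \<Longrightarrow> \<mu> \<le> norm (F x)"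
    proof (cases "K = {}")
      case True then show ?thesis using that[of 1] by auto
    next
      case False
      have "K = cball 0 R \<inter> (\<lambda>x. norm (?L x)) -` {\<epsilon>..}" by (auto simp: K_def)
      then have "closed K"
        by (simp add: continuous_closed_preimage contL continuous_on_norm)
      then have "compact (cball 0 R \<inter> K)" by (intro compact_Int_closed) auto
      moreover have "cball 0 R \<inter> K = K" by (auto simp: K_def)
      ultimately have "compact K" by simp
      have "K \<subseteq> cball 0 R" by (auto simp: K_def)
      then have "continuous_on K (\<lambda>x. norm (F x))"
        by (intro continuous_on_norm continuous_on_subset[OF contF])
      then obtain k where k: "k \<in> K" "\<And>x. x \<in> K \<Longrightarrow> norm (F k) \<le> norm (F x)"
        using continuous_attains_inf[OF \<open>compact K\<close> False] by blast
      have "F k \<noteq> 0"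
      proof
        assume "F k = 0"
        moreover have "k \<in> cball 0 R" and \<epsilon>k: "\<epsilon> \<le> norm (?L k)" using k(1) by (auto simp: K_def)
        ultimately have "k = 0" using F0 by blast
        then show False using \<epsilon>k L0 \<open>0 < \<epsilon>\<close> by simp
      qed
      then show ?thesis using that[of "norm (F k)"] k(2) by simp
    qed
    have "(\<lambda>n. norm (d n) * R) \<longlonglongrightarrow> norm (0 :: complex^'n) * R" by (intro tendsto_intros d0)
    then have "\<forall>\<^sub>F n in sequentially. norm (d n) * R < \<mu>"
      using \<mu>(1) by (intro order_tendstoD(2)) simp_all
    with bound have "\<forall>\<^sub>F n in sequentially. norm (?L (u n)) \<le> R * norm (y n) + R\<^sup>2 * norm (d n) + \<epsilon>"
    proof eventually_elim
      case (elim n)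
      then obtain z where z: "z \<in> cball 0 R" "norm (F z) \<le> norm (d n) * R"
        and le: "norm (?L (u n)) \<le> R * norm (y n) + R\<^sup>2 * norm (d n) + norm (?L z)" by blast
      have "z \<notin> K" using \<mu>(2)[of z] z(2) elim(2) by linarith
      then have "norm (?L z) < \<epsilon>" using z(1) unfolding K_def by simp
      then show ?case using le by linarith
    qed
    moreover have "(\<lambda>n. R * norm (y n) + R\<^sup>2 * norm (d n) + \<epsilon>) \<longlonglongrightarrow> R * norm (F w) + R\<^sup>2 * norm (0 :: complex^'n) + \<epsilon>"
      by (intro tendsto_intros y d0)
    ultimately have "norm (?L w) \<le> R * norm (F w) + R\<^sup>2 * norm (0 :: complex^'n) + \<epsilon>"
      using tendsto_le[OF sequentially_bot _ tendsto_norm[OF Lu]] by blast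
    then show "norm (?L w) \<le> R * norm (F w) + \<epsilon>" by simp
  qed
qed

lemma gradient_eqI:
  fixes f :: "complex^'n \<Rightarrow> complex"
  assumes "(f has_derivative pairing v) (at x)"
  shows "gradient f x = v"
proof -
  have "deriv (\<lambda>z. f (\<chi> j. if j = i then z else x $ j)) (x $ i) = v $ i" for i
  proof -
    let ?\<iota> = "\<lambda>z. \<chi> j. if j = i then z else x $ j"
    have eq: "?\<iota> (x $ i) = x" by (simp add: vec_eq_iff)
    have "(?\<iota> has_derivative (\<lambda>h. \<chi> j. if j = i then h else 0)) (at (x $ i))"
    proof (rule has_derivative_vecI)
      fix j
      show "((\<lambda>z. ?\<iota> z $ j) has_derivative (\<lambda>h. (\<chi> j. if j = i then h else 0) $ j)) (at (x $ i))"
        by (cases "j = i") simp_all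
    qed
    from has_derivative_compose[OF this, of f "pairing v"] assms
    have "((\<lambda>z. f (?\<iota> z)) has_derivative (\<lambda>h. pairing v (\<chi> j. if j = i then h else 0))) (at (x $ i))"
      unfolding eq by simp
    moreover have "(\<lambda>h. pairing v (\<chi> j. if j = i then h else 0)) = (*) (v $ i)"
      by (auto simp: pairing_def if_distrib cong: if_cong)
    ultimately have "((\<lambda>z. f (?\<iota> z)) has_field_derivative v $ i) (at (x $ i))"
      by (simp add: has_field_derivative_def)
    then show ?thesis by (rule DERIV_imp_deriv)
  qed
  then show ?thesis by (simp add: gradient_def vec_eq_iff)
qed

text \<open>
  Three termwise differentiations, for \<open>f\<close>, its gradient, and the Hessian \<open>H\<close>.
\<close>

lemma analytic_germ_regularity:
  fixes f :: "complex^'n \<Rightarrow> complex"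
  assumes "analytic_germ f"
  obtains r H where "0 < r"
    and "\<And>x. x \<in> ball 0 r \<Longrightarrow> (f has_derivative pairing (gradient f x)) (at x)"
    and "\<And>x. x \<in> ball 0 r \<Longrightarrow> (gradient f has_derivative (\<lambda>h. H x *v h)) (at x)"
    and "\<And>x i j. x \<in> ball 0 r \<Longrightarrow> (\<lambda>x. H x $ i $ j) differentiable (at x)"
proof -
  obtain c U where U: "open U" "0 \<in> U"
    and c: "\<And>x. x \<in> U \<Longrightarrow> ((\<lambda>\<alpha>. c \<alpha> * monomial \<alpha> x) has_sum f x) UNIV"
    using assms unfolding analytic_germ_def monomial_def by metis
  obtain s where s: "0 < s" "polydisc s \<subseteq> U" using polydisc_in_neighbourhood[OF U] by blast
  have "power_series_on s f" unfolding power_series_on_def using c s by blast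
  from power_series_has_derivative[OF this, of "s/2"] s obtain D
    where D: "\<And>i. power_series_on (s/2) (D i)"
      and fD: "\<And>x. x \<in> polydisc (s/2) \<Longrightarrow> (f has_derivative (\<lambda>h. \<Sum>i\<in>UNIV. D i x * h $ i)) (at x)"
    by auto
  have "\<exists>E. (\<forall>j. power_series_on (s/4) (E j)) \<and>
      (\<forall>x\<in>polydisc (s/4). (D i has_derivative (\<lambda>h. \<Sum>j\<in>UNIV. E j x * h $ j)) (at x))" for i
    by (rule power_series_has_derivative[OF D[of i], of "s/4"]) (use s in auto)
  then obtain E where E: "\<And>i j. power_series_on (s/4) (E i j)"
      and DE: "\<And>i x. x \<in> polydisc (s/4) \<Longrightarrow> (D i has_derivative (\<lambda>h. \<Sum>j\<in>UNIV. E i j x * h $ j)) (at x)"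
    by metis
  have dE: "E i j differentiable (at x)" if "x \<in> polydisc (s/8)" for i j x
    by (rule power_series_has_derivative[OF E[of i j], of "s/8"]) (use s that in \<open>auto simp: differentiable_def\<close>)
  define H where "H x = (\<chi> i j. E i j x)" for x
  have grad: "gradient f x = (\<chi> i. D i x)" if "x \<in> polydisc (s/2)" for x
    by (rule gradient_eqI) (use fD[OF that] in \<open>simp add: pairing_def[abs_def]\<close>)
  have sub: "polydisc (s/8) \<subseteq> (polydisc (s/4) :: (complex^'n) set)" "polydisc (s/4) \<subseteq> (polydisc (s/2) :: (complex^'n) set)"
    using s by (intro polydisc_mono; simp)+
  have 1: "(f has_derivative pairing (gradient f x)) (at x)" if "x \<in> polydisc (s/2)" for x
    using fD[OF that] by (simp add: grad[OF that] pairing_def[abs_def])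
  have 2: "(gradient f has_derivative (\<lambda>h. H x *v h)) (at x)" if "x \<in> polydisc (s/4)" for x
  proof (rule has_derivative_transform_within_open[OF _ open_polydisc])
    show "((\<lambda>x. \<chi> i. D i x) has_derivative (\<lambda>h. H x *v h)) (at x)"
      by (rule has_derivative_vecI) (use DE[OF that] in \<open>simp add: H_def matrix_vector_mult_def\<close>)
    show "x \<in> polydisc (s/2)" using that sub by auto
  qed (simp add: grad)
  obtain r where r: "0 < r" "ball (0 :: complex^'n) r \<subseteq> polydisc (s/8)"
    using openE[OF open_polydisc zero_in_polydisc[of "s/8"]] s by auto
  show thesis
  proof (rule that[OF r(1), of H])
    fix x :: "complex^'n" assume "x \<in> ball 0 r"
    then have x: "x \<in> polydisc (s/8)" using r by auto
    show "(f has_derivative pairing (gradient f x)) (at x)" using x sub 1 by blast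
    show "(gradient f has_derivative (\<lambda>h. H x *v h)) (at x)" using x sub 2 by blast
    show "(\<lambda>x. H x $ i $ j) differentiable (at x)" for i j using dE[OF x] by (simp add: H_def)
  qed
qed

lemma analytic_germ_isCont:
  assumes "analytic_germ f" shows "isCont f 0"
proof -
  obtain r where r: "0 < r" and "\<And>x. x \<in> ball 0 r \<Longrightarrow> (f has_derivative pairing (gradient f x)) (at x)"
    using analytic_germ_regularity[OF assms] by metis
  then have "(f has_derivative pairing (gradient f 0)) (at 0)" by simp
  then show ?thesis by (rule has_derivative_continuous)
qed

lemma eventually_has_derivative_gradient:
  fixes f :: "complex^'n \<Rightarrow> complex"
  assumes "analytic_germ f"
  shows "\<forall>\<^sub>F x in nhds 0. (f has_derivative pairing (gradient f x)) (at x)"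
proof -
  obtain r where "0 < r" "\<And>x. x \<in> ball 0 r \<Longrightarrow> (f has_derivative pairing (gradient f x)) (at x)"
    using analytic_germ_regularity[OF assms] by metis
  then show ?thesis unfolding eventually_nhds by (intro exI[of _ "ball 0 r"]) auto
qed

text \<open>
  A weak form of the Lojasiewicz gradient inequality: \<open>f x = pairing x (gradient f x) - legendre f (gradient f) x\<close>,
  and both terms are bounded by a multiple of the gradient.
\<close>

lemma analytic_germ_le_gradient:
  fixes f :: "complex^'n \<Rightarrow> complex"
  assumes "analytic_germ f" "f 0 = 0" "isolated_singularity_at_0 f"
  obtains C where "0 \<le> C" "\<forall>\<^sub>F x in nhds 0. norm (f x) \<le> C * norm (gradient f x)"
proof -
  let ?F = "gradient f"
  obtain r and H :: "complex^'n \<Rightarrow> complex^'n^'n" where r: "0 < r"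
    and d1: "\<And>x. x \<in> ball 0 r \<Longrightarrow> (f has_derivative pairing (?F x)) (at x)"
    and d2: "\<And>x. x \<in> ball 0 r \<Longrightarrow> (?F has_derivative (\<lambda>h. H x *v h)) (at x)"
    and d3: "\<And>x i j. x \<in> ball 0 r \<Longrightarrow> (\<lambda>x. H x $ i $ j) differentiable (at x)"
    using analytic_germ_regularity[OF assms(1)] by metis
  obtain U where F0: "?F 0 = 0" and U: "open U" "0 \<in> U" "\<And>x. x \<in> U - {0} \<Longrightarrow> ?F x \<noteq> 0"
    using assms(3) unfolding isolated_singularity_at_0_def by blast
  have "open (U \<inter> ball 0 r)" "0 \<in> U \<inter> ball 0 r" using U r by auto
  then obtain R where R: "0 < R" "cball 0 R \<subseteq> U \<inter> ball 0 r"
    using open_contains_cball by blast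
  have contF: "continuous_on (cball 0 R) ?F"
    using d2 R(2) by (intro continuous_at_imp_continuous_on ballI has_derivative_continuous) blast
  obtain a where a: "a \<in> sphere 0 R" "\<And>x. x \<in> sphere 0 R \<Longrightarrow> norm (?F a) \<le> norm (?F x)"
  proof -
    have "sphere (0 :: complex^'n) R \<noteq> {}" using R by simp
    moreover have "continuous_on (sphere 0 R) (\<lambda>x. norm (?F x))"
      by (intro continuous_on_norm continuous_on_subset[OF contF]) auto
    ultimately show thesis using continuous_attains_inf[OF compact_sphere] that by blast
  qed
  have "?F a \<noteq> 0" using a(1) U(3)[of a] R by auto
  have "isCont ?F 0" by (rule has_derivative_continuous[OF d2]) (simp add: r)
  then have "((\<lambda>x. norm (?F x)) \<longlongrightarrow> norm (?F 0)) (nhds 0)"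
    by (intro tendsto_norm) (simp add: isCont_def tendsto_at_iff_tendsto_nhds)
  moreover have "norm (?F 0) < norm (?F a)" using \<open>?F a \<noteq> 0\<close> F0 by simp
  ultimately have ev1: "\<forall>\<^sub>F x in nhds 0. norm (?F x) < norm (?F a)"
    by (rule order_tendstoD(2))
  have ev2: "\<forall>\<^sub>F x in nhds 0. x \<in> ball (0 :: complex^'n) R"
    using R by (intro eventually_nhds_in_open) auto
  have "\<forall>\<^sub>F x in nhds 0. norm (f x) \<le> 2 * R * norm (?F x)"
    using ev1 ev2
  proof eventually_elim
    case (elim x)
    have "norm (legendre f ?F x) \<le> R * norm (?F x)"
    proof (rule legendre_le_gradient[OF R(1)])
      fix z :: "complex^'n" assume "z \<in> cball 0 R"
      then have z: "z \<in> U" "z \<in> ball 0 r" using R(2) by blast+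
      show "(f has_derivative pairing (?F z)) (at z)" using d1[OF z(2)] .
      show "(?F has_derivative (\<lambda>h. H z *v h)) (at z)" using d2[OF z(2)] .
      show "(\<lambda>x. H x $ i $ j) differentiable (at z)" for i j using d3[OF z(2)] .
      show "?F z = 0 \<Longrightarrow> z = 0" using U(3)[of z] z by blast
    next
      fix z :: "complex^'n" assume "norm z = R"
      then have "norm (?F a) \<le> norm (?F z)" using a(2)[of z] by simp
      then show "norm (?F x) < norm (?F z)" using elim by simp
    qed (use elim assms(2) in auto)
    moreover have "norm (pairing x (?F x)) \<le> R * norm (?F x)"
      using elim by (intro order_trans[OF norm_pairing_le] mult_right_mono) auto
    moreover have "norm (f x) \<le> norm (pairing x (?F x)) + norm (legendre f ?F x)"
      unfolding legendre_def by (metis diff_diff_eq2 add_diff_cancel_left' norm_triangle_ineq4)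
    ultimately show ?case by simp
  qed
  then show thesis using that[of "2 * R"] R by simp
qed

section \<open>Lipschitz germs\<close>

lemma lesssim_at_0_iff_eventually:
  "lesssim_at_0 a b \<longleftrightarrow> (\<exists>C>0. \<forall>\<^sub>F x in nhds 0. a x \<le> C * b x)"
  unfolding lesssim_at_0_def eventually_nhds by blast

lemma Lipschitz_germE:
  assumes "Lipschitz_germ h"
  obtains L U where "0 < L" "open U" "0 \<in> U"
    "\<And>x x'. x \<in> U \<Longrightarrow> x' \<in> U \<Longrightarrow> norm (h x - h x') \<le> L * norm (x - x')"
proof -
  obtain L W where L: "0 < L" and W: "open W" "0 \<in> W"
    and le: "\<forall>p\<in>W. (\<lambda>(x, x'). norm (h x - h x')) p \<le> L * (\<lambda>(x, x'). norm (x - x')) p"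
    using assms unfolding Lipschitz_germ_def lesssim_at_0_def by blast
  obtain A B where AB: "open A" "open B" "0 \<in> A \<times> B" "A \<times> B \<subseteq> W"
    by (rule open_prod_elim[OF W])
  show thesis
  proof (rule that[OF L, of "A \<inter> B"])
    show "open (A \<inter> B)" "0 \<in> A \<inter> B" using AB by (auto simp: zero_prod_def)
    fix x x' assume "x \<in> A \<inter> B" "x' \<in> A \<inter> B"
    then have "(x, x') \<in> W" using AB(4) by blast
    from bspec[OF le this] show "norm (h x - h x') \<le> L * norm (x - x')" by simp
  qed
qed

lemma Lipschitz_germI:
  assumes "0 < L" "open U" "0 \<in> U"
    "\<And>x x'. x \<in> U \<Longrightarrow> x' \<in> U \<Longrightarrow> norm (h x - h x') \<le> L * norm (x - x')"
  shows "Lipschitz_germ h"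
  unfolding Lipschitz_germ_def lesssim_at_0_def
  using assms by (intro exI[of _ L] conjI exI[of _ "U \<times> U"]) (auto simp: zero_prod_def open_Times)

lemma Lipschitz_germ_isCont: "Lipschitz_germ h \<Longrightarrow> isCont h 0"
proof (erule Lipschitz_germE)
  fix L :: real and U assume L: "0 < L" "open U" "0 \<in> U"
    "\<And>x x'. x \<in> U \<Longrightarrow> x' \<in> U \<Longrightarrow> norm (h x - h x') \<le> L * norm (x - x')"
  have "L-lipschitz_on U h" using L by (intro lipschitz_onI) (auto simp: dist_norm)
  then have "continuous_on U h" by (rule lipschitz_on_continuous_on)
  then show "isCont h 0" using L(2,3) continuous_on_eq_continuous_at by blast
qed

lemma isCont_0_eventually:
  assumes "isCont h 0" "h 0 = 0" "\<forall>\<^sub>F x in nhds 0. P x"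
  shows "\<forall>\<^sub>F x in nhds 0. P (h x)"
proof -
  have "(h \<longlongrightarrow> h 0) (nhds 0)"
    using assms(1) by (simp add: isCont_def tendsto_at_iff_tendsto_nhds)
  then have "filterlim h (nhds 0) (nhds 0)" using assms(2) by simp
  then show ?thesis using assms(3) by (simp add: filterlim_iff)
qed

lemma bi_Lipschitz_homeo_germE:
  assumes "bi_Lipschitz_homeo_germ h"
  obtains k where "Lipschitz_germ h" "Lipschitz_germ k" "h 0 = 0" "k 0 = 0"
    "\<forall>\<^sub>F x in nhds 0. k (h x) = x" "\<forall>\<^sub>F y in nhds 0. h (k y) = y"
proof -
  obtain U V k where *: "h 0 = 0" "open U" "open V" "0 \<in> U" "0 \<in> V" "homeomorphism U V h k"
      "Lipschitz_germ h" "Lipschitz_germ k"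
    using assms unfolding bi_Lipschitz_homeo_germ_def by blast
  have "k (h x) = x" if "x \<in> U" for x using *(6) that by (simp add: homeomorphism_def)
  moreover have "h (k y) = y" if "y \<in> V" for y using *(6) that by (simp add: homeomorphism_def)
  ultimately show thesis
    using that[of k] * unfolding eventually_nhds by metis
qed

lemma Lipschitz_germ_compose:
  assumes "Lipschitz_germ a" "Lipschitz_germ k" "k 0 = 0"
  shows "Lipschitz_germ (\<lambda>x. a (k x))"
proof -
  obtain L V where L: "0 < L" and V: "open V" "0 \<in> V"
    and LV: "\<And>x x'. x \<in> V \<Longrightarrow> x' \<in> V \<Longrightarrow> norm (a x - a x') \<le> L * norm (x - x')"
    using Lipschitz_germE[OF assms(1)] by blast
  obtain M W where M: "0 < M" and W: "open W" "0 \<in> W"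
    and MW: "\<And>x x'. x \<in> W \<Longrightarrow> x' \<in> W \<Longrightarrow> norm (k x - k x') \<le> M * norm (x - x')"
    using Lipschitz_germE[OF assms(2)] by blast
  have "\<forall>\<^sub>F x in nhds 0. k x \<in> V"
    by (rule isCont_0_eventually[OF Lipschitz_germ_isCont[OF assms(2)] assms(3) eventually_nhds_in_open[OF V]])
  from eventually_conj[OF this eventually_nhds_in_open[OF W]]
  obtain U where U: "open U" "0 \<in> U" and *: "\<And>x. x \<in> U \<Longrightarrow> k x \<in> V \<and> x \<in> W"
    unfolding eventually_nhds by blast
  have "norm (a (k x) - a (k x')) \<le> (L * M) * norm (x - x')" if "x \<in> U" "x' \<in> U" for x x'
  proof -
    have "norm (a (k x) - a (k x')) \<le> L * norm (k x - k x')" using * LV that by blast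
    also have "\<dots> \<le> L * (M * norm (x - x'))" using * MW that L by (intro mult_left_mono) auto
    finally show ?thesis by simp
  qed
  then show ?thesis using U L M by (intro Lipschitz_germI[of "L * M" U]) auto
qed

lemma Lipschitz_germ_entry:
  fixes A :: "'a::real_normed_vector \<Rightarrow> complex^'p^'q"
  assumes "Lipschitz_germ A"
  shows "Lipschitz_germ (\<lambda>x. A x $ i $ j)"
proof -
  obtain L U where L: "0 < L" and U: "open U" "0 \<in> U"
    and LU: "\<And>x x'. x \<in> U \<Longrightarrow> x' \<in> U \<Longrightarrow> norm (A x - A x') \<le> L * norm (x - x')"
    using Lipschitz_germE[OF assms] by blast
  have "norm (A x $ i $ j - A y $ i $ j) \<le> norm (A x - A y)" for x y
    using Finite_Cartesian_Product.norm_nth_le[of "A x - A y" i]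
      Finite_Cartesian_Product.norm_nth_le[of "(A x - A y) $ i" j] by simp
  then show ?thesis by (intro Lipschitz_germI[OF L U] order_trans[OF _ LU])
qed

section \<open>Comparison of gradients under a Lipschitz change of coordinates\<close>

text \<open>
  The norm of the gradient is the pointwise Lipschitz constant, so it can be read off from the
  increments of the function. The increments of \<open>g \<circ> \<phi>\<close> are controlled by \<open>q\<close> although \<open>\<phi>\<close> is only
  Lipschitz.
\<close>

lemma norm_gradient_le_of_domination:
  assumes df: "(f has_derivative pairing p) (at x)"
    and dg: "(g has_derivative pairing q) (at (\<phi> x))"
    and L: "0 \<le> L" "\<forall>\<^sub>F x' in nhds x. norm (\<phi> x' - \<phi> x) \<le> L * norm (x' - x)"
    and C: "0 \<le> C" "\<forall>\<^sub>F x' in nhds x.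
      norm (f x' - f x) \<le> C * (norm (g (\<phi> x') - g (\<phi> x)) + norm (g (\<phi> x)) * norm (x' - x))"
  shows "norm p \<le> C * (norm q * L + norm (g (\<phi> x)))"
proof (cases "p = 0")
  case True
  then show ?thesis using L(1) C(1) by simp
next
  case False
  show ?thesis
  proof (rule field_le_epsilon)
    fix e :: real assume "0 < e"
    define \<epsilon> where "\<epsilon> = e / (1 + C * L)"
    have CL: "0 < 1 + C * L" using L(1) C(1) by (simp add: add_pos_nonneg)
    have "0 < \<epsilon>" using \<open>0 < e\<close> CL by (simp add: \<epsilon>_def)
    obtain d1 where d1: "0 < d1" "\<And>x'. norm (x' - x) < d1 \<Longrightarrow> norm (f x' - f x - pairing p (x' - x)) \<le> \<epsilon> * norm (x' - x)"
      using df \<open>0 < \<epsilon>\<close> unfolding has_derivative_at_alt by blast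
    obtain d2 where d2: "0 < d2" "\<And>y. norm (y - \<phi> x) < d2 \<Longrightarrow> norm (g y - g (\<phi> x) - pairing q (y - \<phi> x)) \<le> \<epsilon> * norm (y - \<phi> x)"
      using dg \<open>0 < \<epsilon>\<close> unfolding has_derivative_at_alt by blast
    from eventually_conj[OF L(2) C(2)] obtain d3 where d3: "0 < d3"
      "\<And>x'. norm (x' - x) < d3 \<Longrightarrow> norm (\<phi> x' - \<phi> x) \<le> L * norm (x' - x) \<and>
        norm (f x' - f x) \<le> C * (norm (g (\<phi> x') - g (\<phi> x)) + norm (g (\<phi> x)) * norm (x' - x))"
      unfolding eventually_nhds_metric dist_norm by blast
    have "0 < d2 / (L + 1)" using d2(1) L(1) by simp
    then have "0 < min (min d1 d3) (d2 / (L + 1))" using d1(1) d3(1) by simp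
    then obtain \<rho> where "0 < \<rho>" "\<rho> < min (min d1 d3) (d2 / (L + 1))" using dense by blast
    then have \<rho>: "0 < \<rho>" "\<rho> < d1" "\<rho> < d3" "\<rho> < d2 / (L + 1)" by simp_all
    \<comment> \<open>in the direction conjugate to \<open>p\<close> the pairing with \<open>p\<close> attains the product of the norms\<close>
    define h where "h = (\<rho> / norm p) *\<^sub>R (\<chi> i. cnj (p $ i))"
    have "norm (\<chi> i. cnj (p $ i)) = norm p" by (simp add: norm_vec_def)
    then have h: "norm h = \<rho>" using False \<rho> by (simp add: h_def)
    have "pairing p (\<chi> i. cnj (p $ i)) = of_real ((norm p)\<^sup>2)"
      unfolding pairing_def norm_vec_def L2_set_def
      by (simp add: sum_nonneg complex_norm_square del: of_real_power)
    then have ph: "norm (pairing p h) = \<rho> * norm p"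
      using False \<rho> by (simp add: h_def bounded_bilinear.scaleR_right[OF bounded_bilinear_pairing] norm_mult norm_power power2_eq_square)
    define y where "y = \<phi> (x + h)"
    have y: "norm (y - \<phi> x) \<le> L * \<rho>" and dom: "norm (f (x + h) - f x) \<le> C * (norm (g y - g (\<phi> x)) + norm (g (\<phi> x)) * \<rho>)"
      using d3(2)[of "x + h"] h \<rho> by (auto simp: y_def)
    have "L * \<rho> \<le> (L + 1) * \<rho>" using \<rho> by simp
    also have "\<dots> < d2" using \<rho> L(1) by (simp add: field_simps)
    finally have "norm (y - \<phi> x) < d2" using y by simp
    then have "norm (g y - g (\<phi> x)) \<le> norm (pairing q (y - \<phi> x)) + \<epsilon> * norm (y - \<phi> x)"
      using d2(2)[of y] norm_triangle_sub[of "g y - g (\<phi> x)" "pairing q (y - \<phi> x)"] by linarith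
    also have "\<dots> \<le> (norm q + \<epsilon>) * norm (y - \<phi> x)"
      using norm_pairing_le[of q "y - \<phi> x"] by (simp add: distrib_right)
    also have "\<dots> \<le> (norm q + \<epsilon>) * (L * \<rho>)"
      using y \<open>0 < \<epsilon>\<close> by (intro mult_left_mono) auto
    finally have gy: "norm (g y - g (\<phi> x)) \<le> (norm q + \<epsilon>) * (L * \<rho>)" .
    have "\<rho> * norm p \<le> norm (f (x + h) - f x) + \<epsilon> * \<rho>"
      using d1(2)[of "x + h"] h \<rho> ph norm_triangle_sub[of "pairing p h" "f (x + h) - f x"]
      by (simp add: norm_minus_commute)
    also have "\<dots> \<le> C * ((norm q + \<epsilon>) * (L * \<rho>) + norm (g (\<phi> x)) * \<rho>) + \<epsilon> * \<rho>"
      using dom gy C(1) by (smt (verit) mult_left_mono)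
    also have "\<dots> = \<rho> * (C * (norm q * L + norm (g (\<phi> x))) + \<epsilon> * (1 + C * L))"
      by (simp add: algebra_simps)
    finally have "norm p \<le> C * (norm q * L + norm (g (\<phi> x))) + \<epsilon> * (1 + C * L)"
      using \<rho>(1) by simp
    then show "norm p \<le> C * (norm q * L + norm (g (\<phi> x))) + e"
      using CL by (simp add: \<epsilon>_def)
  qed
qed

text \<open>
  The common consequence of the two equivalences. The second term on the right comes from
  the variation of the matrix \<open>A\<close> in a K*-equivalence.
\<close>

definition difference_dominated ::
    "(complex^'n \<Rightarrow> complex) \<Rightarrow> (complex^'n \<Rightarrow> complex) \<Rightarrow> (complex^'n \<Rightarrow> complex^'n) \<Rightarrow> bool"
  where "difference_dominated f g \<phi> \<longleftrightarrow> (\<exists>C\<ge>0. \<exists>U. open U \<and> 0 \<in> U \<and> (\<forall>x\<in>U. \<forall>x'\<in>U.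
    norm (f x' - f x) \<le> C * (norm (g (\<phi> x') - g (\<phi> x)) + norm (g (\<phi> x)) * norm (x' - x))))"

text \<open>
  Domination gives \<open>norm (gradient f x) \<le> C * (L * norm (gradient g (\<phi> x)) + norm (g (\<phi> x)))\<close>; the gradient
  inequality for \<open>g\<close> removes the last term. Substituting \<open>x = k y\<close>, every exponent admissible for \<open>f\<close> is
  admissible for \<open>g\<close>.
\<close>

lemma Lojasiewicz_exponent_le:
  fixes f g :: "complex^'n \<Rightarrow> complex"
  assumes f: "analytic_germ f" and g: "analytic_germ g" "g 0 = 0" "isolated_singularity_at_0 g"
    and \<phi>: "Lipschitz_germ \<phi>" "\<phi> 0 = 0" and k: "isCont k 0" "k 0 = 0" "\<forall>\<^sub>F y in nhds 0. \<phi> (k y) = y"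
    and dom: "difference_dominated f g \<phi>"
  shows "Lojasiewicz_exponent (gradient g) \<le> Lojasiewicz_exponent (gradient f)"
proof -
  obtain L V where L: "0 < L" and V: "open V" "0 \<in> V"
    and LV: "\<And>x x'. x \<in> V \<Longrightarrow> x' \<in> V \<Longrightarrow> norm (\<phi> x - \<phi> x') \<le> L * norm (x - x')"
    using Lipschitz_germE[OF \<phi>(1)] by blast
  obtain C U where C: "0 \<le> C" and U: "open U" "0 \<in> U"
    and CU: "\<And>x x'. x \<in> U \<Longrightarrow> x' \<in> U \<Longrightarrow>
      norm (f x' - f x) \<le> C * (norm (g (\<phi> x') - g (\<phi> x)) + norm (g (\<phi> x)) * norm (x' - x))"
    using dom unfolding difference_dominated_def by blast
  obtain K where K: "0 \<le> K" "\<forall>\<^sub>F y in nhds 0. norm (g y) \<le> K * norm (gradient g y)"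
    using analytic_germ_le_gradient[OF g] .
  have \<phi>c: "isCont \<phi> 0" using \<phi>(1) by (rule Lipschitz_germ_isCont)
  define M where "M = C * (L + K) + 1"
  have M: "0 < M" using C L K by (auto simp: M_def intro!: add_nonneg_pos)
  have "\<forall>\<^sub>F x in nhds 0. norm (gradient f x) \<le> M * norm (gradient g (\<phi> x))"
    using eventually_has_derivative_gradient[OF f] eventually_nhds_in_open[OF U] eventually_nhds_in_open[OF V]
      isCont_0_eventually[OF \<phi>c \<phi>(2) K(2)]
      isCont_0_eventually[OF \<phi>c \<phi>(2) eventually_has_derivative_gradient[OF g(1)]]
  proof eventually_elim
    case (elim x)
    have "norm (gradient f x) \<le> C * (norm (gradient g (\<phi> x)) * L + norm (g (\<phi> x)))"
    proof (rule norm_gradient_le_of_domination[where f = f and g = g and \<phi> = \<phi> and x = x])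
      show "\<forall>\<^sub>F x' in nhds x. norm (\<phi> x' - \<phi> x) \<le> L * norm (x' - x)"
        by (rule eventually_mono[OF eventually_nhds_in_open[OF V(1) elim(3)]]) (rule LV[OF _ elim(3)])
      show "\<forall>\<^sub>F x' in nhds x. norm (f x' - f x) \<le> C * (norm (g (\<phi> x') - g (\<phi> x)) + norm (g (\<phi> x)) * norm (x' - x))"
        by (rule eventually_mono[OF eventually_nhds_in_open[OF U(1) elim(2)]]) (rule CU[OF elim(2)])
    qed (use elim C L in auto)
    also have "\<dots> \<le> C * (norm (gradient g (\<phi> x)) * L + K * norm (gradient g (\<phi> x)))"
      using elim C by (intro mult_left_mono add_left_mono) auto
    also have "\<dots> \<le> M * norm (gradient g (\<phi> x))" by (simp add: M_def algebra_simps)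
    finally show ?case .
  qed
  note grad = isCont_0_eventually[OF k(1,2) this]
  show ?thesis
    unfolding Lojasiewicz_exponent_def
  proof (rule INF_superset_mono, safe)
    fix \<alpha> :: real assume \<alpha>: "0 \<le> \<alpha>"
      and "lesssim_at_0 (\<lambda>x. norm x powr \<alpha>) (\<lambda>x. norm (gradient f x))"
    then obtain B where B: "0 < B" "\<forall>\<^sub>F x in nhds 0. norm x powr \<alpha> \<le> B * norm (gradient f x)"
      unfolding lesssim_at_0_iff_eventually by blast
    have "\<forall>\<^sub>F y in nhds 0. norm y powr \<alpha> \<le> (L powr \<alpha> * B * M) * norm (gradient g y)"
      using grad isCont_0_eventually[OF k(1,2) B(2)] k(3)
        isCont_0_eventually[OF k(1,2) eventually_nhds_in_open[OF V]]
    proof eventually_elim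
      case (elim y)
      have "norm y \<le> L * norm (k y)" using LV[OF elim(4) V(2)] elim(3) \<phi>(2) by simp
      then have "norm y powr \<alpha> \<le> (L * norm (k y)) powr \<alpha>" using \<alpha> by (intro powr_mono2) auto
      also have "\<dots> = L powr \<alpha> * norm (k y) powr \<alpha>" by (rule powr_mult)
      also have "\<dots> \<le> L powr \<alpha> * (B * (M * norm (gradient g y)))"
        using elim B by (intro mult_left_mono order_trans[OF elim(2)]) auto
      finally show ?case by (simp add: mult_ac)
    qed
    moreover have "0 < L powr \<alpha> * B * M" using L B M by simp
    ultimately show "lesssim_at_0 (\<lambda>x. norm x powr \<alpha>) (\<lambda>x. norm (gradient g x))"
      unfolding lesssim_at_0_iff_eventually by blast
  qed
qed

section \<open>Invariance of the Lojasiewicz exponent\<close>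

lemma difference_dominated_postcompose:
  assumes m: "Lipschitz_germ m" and "isCont (\<lambda>x. g (\<phi> x)) 0" "g (\<phi> 0) = 0"
    and eq: "\<forall>\<^sub>F x in nhds 0. f x = m (g (\<phi> x))"
  shows "difference_dominated f g \<phi>"
proof -
  obtain L V where L: "0 < L" and V: "open V" "0 \<in> V"
    and LV: "\<And>x x'. x \<in> V \<Longrightarrow> x' \<in> V \<Longrightarrow> norm (m x - m x') \<le> L * norm (x - x')"
    using Lipschitz_germE[OF m] by blast
  have "\<forall>\<^sub>F x in nhds 0. g (\<phi> x) \<in> V"
    by (rule isCont_0_eventually[where h = "\<lambda>x. g (\<phi> x)", OF assms(2,3) eventually_nhds_in_open[OF V]])
  from eventually_conj[OF this eq] obtain U where U: "open U" "0 \<in> U"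
      and *: "\<And>x. x \<in> U \<Longrightarrow> g (\<phi> x) \<in> V \<and> f x = m (g (\<phi> x))"
    unfolding eventually_nhds by blast
  have "norm (f x' - f x) \<le> L * (norm (g (\<phi> x') - g (\<phi> x)) + norm (g (\<phi> x)) * norm (x' - x))"
    if "x \<in> U" "x' \<in> U" for x x'
  proof -
    have "norm (f x' - f x) \<le> L * norm (g (\<phi> x') - g (\<phi> x))"
      using *[OF that(1)] *[OF that(2)] LV by auto
    also have "\<dots> \<le> L * (norm (g (\<phi> x') - g (\<phi> x)) + norm (g (\<phi> x)) * norm (x' - x))"
      using L by (intro mult_left_mono) auto
    finally show ?thesis .
  qed
  then show ?thesis unfolding difference_dominated_def using U L by (meson less_imp_le)
qed

lemma difference_dominated_multiply:
  fixes b :: "complex^'n \<Rightarrow> complex"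
  assumes b: "Lipschitz_germ b" and eq: "\<forall>\<^sub>F x in nhds 0. f x = b x * g (\<phi> x)"
  shows "difference_dominated f g \<phi>"
proof -
  obtain L V where L: "0 < L" and V: "open V" "0 \<in> V"
    and LV: "\<And>x x'. x \<in> V \<Longrightarrow> x' \<in> V \<Longrightarrow> norm (b x - b x') \<le> L * norm (x - x')"
    using Lipschitz_germE[OF b] by blast
  define N where "N = norm (b 0) + 1"
  have "((\<lambda>x. norm (b x)) \<longlongrightarrow> norm (b 0)) (nhds 0)"
    using Lipschitz_germ_isCont[OF b]
    by (intro tendsto_norm) (simp add: isCont_def tendsto_at_iff_tendsto_nhds)
  then have "\<forall>\<^sub>F x in nhds 0. norm (b x) < N" by (rule order_tendstoD) (simp add: N_def)
  from eventually_conj[OF this eventually_conj[OF eq eventually_nhds_in_open[OF V]]]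
  obtain U where U: "open U" "0 \<in> U"
      and *: "\<And>x. x \<in> U \<Longrightarrow> norm (b x) < N \<and> f x = b x * g (\<phi> x) \<and> x \<in> V"
    unfolding eventually_nhds by blast
  have "norm (f x' - f x) \<le> (N + L) * (norm (g (\<phi> x') - g (\<phi> x)) + norm (g (\<phi> x)) * norm (x' - x))"
    if x: "x \<in> U" "x' \<in> U" for x x'
  proof -
    let ?u = "g (\<phi> x') - g (\<phi> x)"
    have "f x' - f x = b x' * ?u + (b x' - b x) * g (\<phi> x)"
      using *[OF x(1)] *[OF x(2)] by (simp add: algebra_simps)
    then have "norm (f x' - f x) \<le> norm (b x') * norm ?u + norm (b x' - b x) * norm (g (\<phi> x))"
      by (metis norm_mult norm_triangle_ineq)
    also have "\<dots> \<le> N * norm ?u + (L * norm (x' - x)) * norm (g (\<phi> x))"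
      using *[OF x(1)] *[OF x(2)] LV by (intro add_mono mult_right_mono) auto
    also have "\<dots> \<le> (N + L) * norm ?u + (N + L) * (norm (g (\<phi> x)) * norm (x' - x))"
      using L by (intro add_mono) (auto simp: N_def algebra_simps)
    finally show ?thesis by (simp add: distrib_left)
  qed
  moreover have "0 \<le> N + L" using L by (simp add: N_def)
  ultimately show ?thesis unfolding difference_dominated_def using U by blast
qed

lemma Lojasiewicz_exponent_A_invariant:
  fixes f g :: "complex^'n \<Rightarrow> complex"
  assumes f: "analytic_germ f" "f 0 = 0" "isolated_singularity_at_0 f"
    and g: "analytic_germ g" "g 0 = 0" "isolated_singularity_at_0 g"
    and "bi_Lipschitz_A_equivalent f g"
  shows "Lojasiewicz_exponent (gradient f) = Lojasiewicz_exponent (gradient g)"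
proof -
  obtain \<phi> \<psi> where homeo: "bi_Lipschitz_homeo_germ \<phi>" "bi_Lipschitz_homeo_germ \<psi>"
    and eq: "\<forall>\<^sub>F x in nhds 0. \<psi> (f x) = g (\<phi> x)"
    using assms(7) unfolding bi_Lipschitz_A_equivalent_def eventually_nhds by blast
  obtain k where \<phi>: "Lipschitz_germ \<phi>" "Lipschitz_germ k" "\<phi> 0 = 0" "k 0 = 0"
      "\<forall>\<^sub>F x in nhds 0. k (\<phi> x) = x" "\<forall>\<^sub>F y in nhds 0. \<phi> (k y) = y"
    by (rule bi_Lipschitz_homeo_germE[OF homeo(1)])
  obtain m where \<psi>: "Lipschitz_germ \<psi>" "Lipschitz_germ m" "\<psi> 0 = 0" "m 0 = 0"
      "\<forall>\<^sub>F x in nhds 0. m (\<psi> x) = x" "\<forall>\<^sub>F y in nhds 0. \<psi> (m y) = y"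
    by (rule bi_Lipschitz_homeo_germE[OF homeo(2)])
  have c: "isCont \<phi> 0" "isCont k 0" "isCont f 0" "isCont g 0"
    using \<phi> f g by (simp_all add: Lipschitz_germ_isCont analytic_germ_isCont)
  have c\<phi>: "isCont (\<lambda>x. g (\<phi> x)) 0" by (rule isCont_o2[OF c(1)]) (simp add: c \<phi>)
  have ck: "isCont (\<lambda>y. f (k y)) 0" by (rule isCont_o2[OF c(2)]) (simp add: c \<phi>)
  have "\<forall>\<^sub>F x in nhds 0. f x = m (g (\<phi> x))"
    using isCont_0_eventually[OF c(3) f(2) \<psi>(5)] eq by eventually_elim simp
  then have 1: "difference_dominated f g \<phi>"
    by (rule difference_dominated_postcompose[where m = m and g = g and \<phi> = \<phi>, OF \<psi>(2) c\<phi>, rotated])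
       (simp add: \<phi> g)
  have "\<forall>\<^sub>F y in nhds 0. g y = \<psi> (f (k y))"
    using isCont_0_eventually[OF c(2) \<phi>(4) eq] \<phi>(6) by eventually_elim simp
  then have 2: "difference_dominated g f k"
    by (rule difference_dominated_postcompose[where m = \<psi> and g = f and \<phi> = k, OF \<psi>(1) ck, rotated])
       (simp add: \<phi> f)
  show ?thesis
    using Lojasiewicz_exponent_le[OF f(1) g \<phi>(1,3) c(2) \<phi>(4,6) 1]
      Lojasiewicz_exponent_le[OF g(1) f \<phi>(2,4) c(1) \<phi>(3,5) 2] by (rule antisym[rotated])
qed

lemma Lojasiewicz_exponent_K_star_invariant:
  fixes f g :: "complex^'n \<Rightarrow> complex"
  assumes f: "analytic_germ f" "f 0 = 0" "isolated_singularity_at_0 f"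
    and g: "analytic_germ g" "g 0 = 0" "isolated_singularity_at_0 g"
    and "bi_Lipschitz_K_star_equivalent (\<lambda>x. vec (f x) :: complex^1) (\<lambda>x. vec (g x) :: complex^1)"
  shows "Lojasiewicz_exponent (gradient f) = Lojasiewicz_exponent (gradient g)"
proof -
  obtain \<phi> and A :: "complex^'n \<Rightarrow> complex^1^1" where homeo: "bi_Lipschitz_homeo_germ \<phi>"
    and A: "Lipschitz_germ A" "Lipschitz_germ (\<lambda>x. matrix_inv (A x))"
    and ev: "\<forall>\<^sub>F x in nhds 0. invertible (A x) \<and> A x *v vec (f x) = vec (g (\<phi> x))"
    using assms(7) unfolding bi_Lipschitz_K_star_equivalent_def eventually_nhds by blast
  obtain k where \<phi>: "Lipschitz_germ \<phi>" "Lipschitz_germ k" "\<phi> 0 = 0" "k 0 = 0"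
      "\<forall>\<^sub>F x in nhds 0. k (\<phi> x) = x" "\<forall>\<^sub>F y in nhds 0. \<phi> (k y) = y"
    by (rule bi_Lipschitz_homeo_germE[OF homeo])
  define a b where "a x = A x $ 1 $ 1" and "b x = matrix_inv (A x) $ 1 $ 1" for x
  have ab: "Lipschitz_germ a" "Lipschitz_germ b"
    unfolding a_def[abs_def] b_def[abs_def] by (rule Lipschitz_germ_entry[OF A(1)], rule Lipschitz_germ_entry[OF A(2)])
  have ag: "\<forall>\<^sub>F x in nhds 0. a x * f x = g (\<phi> x)"
    using ev by eventually_elim (auto simp: a_def vec_eq_iff matrix_vector_mult_def)
  have "\<forall>\<^sub>F x in nhds 0. f x = b x * g (\<phi> x)"
    using ev
  proof eventually_elim
    case (elim x)
    then have "\<exists>B. A x ** B = mat 1 \<and> B ** A x = mat 1" by (simp add: invertible_def)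
    from someI_ex[OF this] have inv: "matrix_inv (A x) ** A x = mat 1" by (simp add: matrix_inv_def)
    have "matrix_inv (A x) *v vec (g (\<phi> x)) = matrix_inv (A x) *v (A x *v vec (f x))"
      using elim by simp
    also have "\<dots> = (vec (f x) :: complex^1)"
      by (simp only: matrix_vector_mul_assoc inv matrix_vector_mul_lid)
    finally have "matrix_inv (A x) *v vec (g (\<phi> x)) = (vec (f x) :: complex^1)" .
    then show ?case by (auto simp: b_def vec_eq_iff matrix_vector_mult_def)
  qed
  then have 1: "difference_dominated f g \<phi>"
    by (rule difference_dominated_multiply[where b = b and g = g and \<phi> = \<phi>, OF ab(2)])
  have c: "isCont \<phi> 0" "isCont k 0" using \<phi> by (simp_all add: Lipschitz_germ_isCont)
  have "\<forall>\<^sub>F y in nhds 0. g y = a (k y) * f (k y)"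
    using isCont_0_eventually[OF c(2) \<phi>(4) ag] \<phi>(6) by eventually_elim simp
  then have 2: "difference_dominated g f k"
    by (rule difference_dominated_multiply[where b = "\<lambda>y. a (k y)" and g = f and \<phi> = k,
          OF Lipschitz_germ_compose[OF ab(1) \<phi>(2,4)]])
  show ?thesis
    using Lojasiewicz_exponent_le[OF f(1) g \<phi>(1,3) c(2) \<phi>(4,6) 1]
      Lojasiewicz_exponent_le[OF g(1) f \<phi>(2,4) c(1) \<phi>(3,5) 2] by (rule antisym[rotated])
qed

theorem theorem6p1:
  fixes f g :: "complex^'n \<Rightarrow> complex"
  assumes "analytic_germ f" and "f 0 = 0" and "isolated_singularity_at_0 f"
    and "analytic_germ g" and "g 0 = 0" and "isolated_singularity_at_0 g"
    and "bi_Lipschitz_A_equivalent f g \<or>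
         bi_Lipschitz_K_star_equivalent (\<lambda>x. vec (f x) :: complex^1) (\<lambda>x. vec (g x) :: complex^1)"
  shows "Lojasiewicz_exponent (gradient f) = Lojasiewicz_exponent (gradient g)"
  using assms Lojasiewicz_exponent_A_invariant Lojasiewicz_exponent_K_star_invariant by blast

end
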